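(* Let $g_\nu(z)=2^{\nu}\Gamma(\nu+1)z^{1-\nu}J_\nu(z)$. (i) If $\nu>-1$, then the radius of uniform convexity $r^{uc}(g_\nu)$ of $g_{\nu}$ is the smallest positive root $r$ of the equation $$1+2r\,\frac{(2\nu-1)J_{\nu+1}(r)-rJ_{\nu}(r)}{J_{\nu}(r)-rJ_{\nu+1}(r)}=0.$$ Moreover, $r^{uc}(g_{\nu})<\alpha_{\nu,1}<j_{\nu,1}$, where $\alpha_{\nu,1}$ is the first positive zero of the Dini function $z\mapsto(1-\nu)J_{\nu}(z)+zJ_{\nu}'(z)$ and $j_{\nu,1}$ is the first positive zero of $J_\nu$. (ii) If $\nu\in(-2,-1)$, then the radius of uniform convexity $r^{uc}(g_{\nu})$ of $g_\nu$ is the unique root $r$ of the equation $$1+2r\,\frac{rI_{\nu}(r)-(2\nu-1)I_{\nu+1}(r)}{I_{\nu}(r)+rI_{\nu+1}(r)}=0$$ in the interval $(0,a)$, where $a>0$ is such that $\pm ia$ are the purely imaginary zeros of the Dini function $z\mapsto(1-\nu)J_{\nu}(z)+zJ_{\nu}'(z)$.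
   Context: $J_\nu$ is the Bessel function of the first kind of order $\nu$: $J_{\nu}(z)=\sum_{n\ge 0}\frac{(-1)^{n}}{n!\,\Gamma(n+\nu+1)}\left(\frac z2\right)^{2n+\nu}$. $I_\nu$ is the modified Bessel function of the first kind, $I_\nu(z)=i^{-\nu}J_\nu(iz)=\sum_{n\ge0}\frac{1}{n!\,\Gamma(n+\nu+1)}\left(\frac z2\right)^{2n+\nu}$. The normalized function is $g_\nu(z)=2^{\nu}\Gamma(\nu+1)z^{1-\nu}J_\nu(z)=z-\frac{1}{4(\nu+1)}z^{3}+\frac{1}{32(\nu+1)(\nu+2)}z^5-\dots$ (an entire function). Write $U(r)=\{z\in\mathbb C:|z|<r\}$. For $f(z)=z+\sum_{n\ge2}a_nz^n$ with radius of convergence $r_f\in(0,\infty]$, the radius of uniform convexity is $$r^{uc}(f)=\sup\left\{r\in(0,r_f):\ \operatorname{Re}\left(1+\frac{zf''(z)}{f'(z)}\right)>\left|\frac{zf''(z)}{f'(z)}\right|\ \text{for all } z\in U(r)\right\}.$$ For $\nu\in(-2,-1)$, the function $z\mapsto z^{-\nu}\left[(1-\nu)J_\nu(z)+zJ_\nu'(z)\right]$ has exactly one pair of conjugate purely imaginary zeros, denoted $\pm ia$ with $a>0$, all its other zeros being real. *)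

theory Defs
  imports "HOL-Complex_Analysis.Complex_Analysis"
begin

text \<open>
  Principal branch of the power with real exponent. The library has \<open>0 powr 0 = 0\<close>; the case
  distinction restores \<open>z\<^sup>0 = 1\<close>, so that \<open>bessel_J 0 0 = 1\<close>.
\<close>
definition rpow :: "complex \<Rightarrow> real \<Rightarrow> complex" where
  "rpow z s = (if s = 0 then 1 else z powr of_real s)"

text \<open>
  \<open>rGamma\<close> is the entire function \<open>1 / \<Gamma>\<close>, so a term with \<open>n + \<nu> + 1\<close> a pole of \<open>\<Gamma>\<close> vanishes. The
  only value without the usual meaning is the one at \<open>z = 0\<close> for negative non-integer \<open>\<nu>\<close>.
\<close>
definition bessel_J :: "real \<Rightarrow> complex \<Rightarrow> complex" where
  "bessel_J \<nu> z =
     (\<Sum>n. (-1) ^ n * of_real (rGamma (real n + \<nu> + 1)) / fact n * rpow (z / 2) (2 * real n + \<nu>))"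

definition bessel_I :: "real \<Rightarrow> complex \<Rightarrow> complex" where
  "bessel_I \<nu> z =
     (\<Sum>n. of_real (rGamma (real n + \<nu> + 1)) / fact n * rpow (z / 2) (2 * real n + \<nu>))"

text \<open>
  Both powers use the same branch, so their product is \<open>z\<close> times an even entire function, also on
  the branch cut; at \<open>z = 0\<close> the product is \<open>0\<close>. Hence this formula is the entire function
  \<open>z - z\<^sup>3 / (4 (\<nu> + 1)) + \<dots>\<close> on the whole plane (for \<open>\<nu>\<close> not a negative integer).
\<close>
definition bessel_g :: "real \<Rightarrow> complex \<Rightarrow> complex" where
  "bessel_g \<nu> z = of_real (2 powr \<nu> * Gamma (\<nu> + 1)) * rpow z (1 - \<nu>) * bessel_J \<nu> z"

text \<open>
  The derivative is the classical one off the branch cut \<open>z \<le> 0\<close>, in particular at positive real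
  and at nonzero purely imaginary \<open>z\<close>. At \<open>z = 0\<close> the value need not be meaningful.
\<close>
definition dini :: "real \<Rightarrow> complex \<Rightarrow> complex" where
  "dini \<nu> z = of_real (1 - \<nu>) * bessel_J \<nu> z + z * deriv (bessel_J \<nu>) z"

text \<open>
  For \<open>f\<close> with \<open>f(z) = z + \<dots>\<close> the sum of its Taylor series at \<open>0\<close>. The supremum is taken in the
  extended reals, since the set may be unbounded. The condition \<open>f'(z) \<noteq> 0\<close>, implicit in writing
  \<open>z f''(z) / f'(z)\<close>, is made explicit because division by \<open>0\<close> yields \<open>0\<close>.
\<close>
definition radius_uniform_convexity :: "(complex \<Rightarrow> complex) \<Rightarrow> ereal" where
  "radius_uniform_convexity f =
     Sup {ereal r | r. 0 < r \<and> ereal r < fps_conv_radius (fps_expansion f 0) \<and>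
       (\<forall>z\<in>ball 0 r. deriv f z \<noteq> 0 \<and>
          Re (1 + z * deriv (deriv f) z / deriv f z) > norm (z * deriv (deriv f) z / deriv f z))}"

definition is_first_positive_zero :: "(complex \<Rightarrow> complex) \<Rightarrow> real \<Rightarrow> bool" where
  "is_first_positive_zero F x \<longleftrightarrow>
     0 < x \<and> F (of_real x) = 0 \<and> (\<forall>y. 0 < y \<and> y < x \<longrightarrow> F (of_real y) \<noteq> 0)"

text \<open>
  The left-hand sides of the two equations. Where a denominator vanishes, the library value is
  \<open>1\<close>, so such points are not counted as roots.
\<close>
definition uc_eq_J :: "real \<Rightarrow> complex \<Rightarrow> complex" where
  "uc_eq_J \<nu> r = 1 + 2 * r *
     ((of_real (2 * \<nu> - 1) * bessel_J (\<nu> + 1) r - r * bessel_J \<nu> r) /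
      (bessel_J \<nu> r - r * bessel_J (\<nu> + 1) r))"

definition uc_eq_I :: "real \<Rightarrow> complex \<Rightarrow> complex" where
  "uc_eq_I \<nu> r = 1 + 2 * r *
     ((r * bessel_I \<nu> r - of_real (2 * \<nu> - 1) * bessel_I (\<nu> + 1) r) /
      (bessel_I \<nu> r + r * bessel_I (\<nu> + 1) r))"

end

theory Submission
  imports Defs
begin

text \<open>
  With \<open>t = z\<^sup>2 / 4\<close>, the derivative of \<open>g\<^sub>\<nu>\<close> is an entire function \<open>D(t)\<close>, and
  \<open>z g''(z) / g'(z) = 2 t D'(t) / D(t)\<close>. Both equations of the theorem read
  \<open>1 + 4 t D'(t) / D(t) = 0\<close>, with \<open>t\<close> replaced by \<open>- t\<close> in the second case. Instead of a Hadamard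
  factorisation of \<open>D\<close>, the proof uses that all Taylor coefficients of \<open>L = - D' / D\<close> are nonnegative:
  then \<open>|t L(t)| \<le> |t| L(|t|)\<close>, the disc of convergence of \<open>L\<close> reaches the first positive zero of
  \<open>D\<close> (Pringsheim), and \<open>2 |z g'' / g'| < 1\<close> holds precisely up to the point where \<open>4 t L(t) = 1\<close>.

  For \<open>\<nu> \<in> (-2, -1)\<close> this nonnegativity is immediate, because \<open>D(- t)\<close> is \<open>1\<close> minus a series with
  positive coefficients. For \<open>\<nu> > -1\<close> let \<open>K(t)\<close> be the normalised Bessel series with \<open>g(z) = z K(t)\<close>.
  The coefficients of \<open>Y = - K' / K\<close> (the Rayleigh sums) are positive by the Riccati equation
  \<open>(\<nu> + 1) Y + t Y' = 1 + t Y\<^sup>2\<close>, and \<open>D = K (1 - 2 t Y)\<close> yields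
  \<open>L = Y + (2 t Y)' / (1 - 2 t Y)\<close>. A geometric lower bound for the Rayleigh sums shows that \<open>Y\<close>
  has a finite radius of convergence, so that \<open>K\<close> has a positive zero.
\<close>

unbundle no vec_syntax

section \<open>Power series with nonnegative logarithmic derivative\<close>

definition complex_fps :: "real fps \<Rightarrow> complex fps" where
  "complex_fps f = Abs_fps (\<lambda>n. of_real (f $ n))"

lemma complex_fps_nth [simp]: "complex_fps f $ n = of_real (f $ n)"
  by (simp add: complex_fps_def)

lemma complex_fps_1: "complex_fps 1 = 1"
  by (auto simp: fps_eq_iff)

lemma complex_fps_mult: "complex_fps (f * g) = complex_fps f * complex_fps g"
  by (simp add: fps_eq_iff fps_mult_nth)

lemma complex_fps_deriv: "complex_fps (fps_deriv f) = fps_deriv (complex_fps f)"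
  by (simp add: fps_eq_iff)

lemma complex_fps_uminus: "complex_fps (- f) = - complex_fps f"
  by (simp add: fps_eq_iff)

lemma complex_fps_inverse:
  assumes "f $ 0 \<noteq> 0"
  shows "complex_fps (inverse f) = inverse (complex_fps f)"
proof (rule fps_inverse_unique[symmetric])
  show "complex_fps f * complex_fps (inverse f) = 1"
    using assms by (simp add: complex_fps_mult[symmetric] complex_fps_1 inverse_mult_eq_1')
qed

lemma fps_conv_radius_complex_fps [simp]: "fps_conv_radius (complex_fps f) = fps_conv_radius f"
proof -
  have "conv_radius (\<lambda>n. norm (of_real (f $ n) :: complex)) = conv_radius (\<lambda>n. norm (f $ n))"
    by simp
  then show ?thesis
    unfolding conv_radius_norm by (simp add: fps_conv_radius_def complex_fps_def)
qed

lemma eval_complex_fps_of_real: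
  assumes "ereal (norm x) < fps_conv_radius f"
  shows "eval_fps (complex_fps f) (of_real x) = of_real (eval_fps f x)"
proof -
  have "(\<lambda>n. of_real (f $ n * x ^ n) :: complex) sums of_real (eval_fps f x)"
    using sums_eval_fps[OF assms] by (rule sums_of_real)
  then show ?thesis
    by (simp add: eval_fps_def sums_iff)
qed

lemma norm_eval_complex_fps_le:
  assumes "\<And>n. 0 \<le> f $ n" "ereal (norm z) < fps_conv_radius f"
  shows "norm (eval_fps (complex_fps f) z) \<le> eval_fps f (norm z)"
proof -
  have n: "norm (complex_fps f $ n * z ^ n) = f $ n * norm z ^ n" for n
    using assms(1)[of n] by (simp add: norm_mult norm_power)
  have "summable (\<lambda>n. norm (complex_fps f $ n * z ^ n))"
    using assms(2) by (intro norm_summable_fps) auto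
  from summable_norm[OF this] show ?thesis
    unfolding n by (simp add: eval_fps_def)
qed

lemma eval_fps_real_mono:
  fixes f :: "real fps"
  assumes "\<And>n. 0 \<le> f $ n" "0 \<le> x" "x \<le> y" "ereal y < fps_conv_radius f"
  shows "eval_fps f x \<le> eval_fps f y"
proof -
  have r: "ereal (norm x) < fps_conv_radius f" "ereal (norm y) < fps_conv_radius f"
    using assms le_less_trans[of "ereal x" "ereal y"] by auto
  show ?thesis unfolding eval_fps_def
    by (rule suminf_le) (use assms r in \<open>auto intro!: summable_fps mult_left_mono power_mono\<close>)
qed

lemma fps_mult_nonneg:
  fixes f g :: "real fps"
  assumes "\<And>n. 0 \<le> f $ n" "\<And>n. 0 \<le> g $ n"
  shows "0 \<le> (f * g) $ n"
  using assms by (auto simp: fps_mult_nth intro!: sum_nonneg)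

lemma fps_deriv_nonneg:
  fixes f :: "real fps"
  assumes "\<And>n. 0 \<le> f $ n"
  shows "0 \<le> fps_deriv f $ n"
  using assms by simp

lemma fps_inverse_one_minus_nonneg:
  fixes p :: "real fps"
  assumes "p $ 0 = 0" "\<And>n. 0 \<le> p $ n"
  shows "0 \<le> inverse (1 - p) $ n"
proof (induction n rule: less_induct)
  case (less n)
  have "(1 - p) * inverse (1 - p) = 1"
    using assms by (intro inverse_mult_eq_1') auto
  then have "inverse (1 - p) = 1 + p * inverse (1 - p)"
    by (simp add: algebra_simps)
  then have "inverse (1 - p) $ n = 1 $ n + (\<Sum>i=0..n. p $ i * inverse (1 - p) $ (n - i))"
    by (metis fps_add_nth fps_mult_nth)
  also have "\<dots> \<ge> 0"
  proof (intro add_nonneg_nonneg sum_nonneg)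
    fix i assume "i \<in> {0..n}"
    then show "0 \<le> p $ i * inverse (1 - p) $ (n - i)"
      using assms less.IH[of "n - i"] by (cases "i = 0") auto
  qed auto
  finally show ?case .
qed

lemma fps_inverse_nonneg_of_logderiv:
  fixes H L :: "real fps"
  assumes "H $ 0 = 1" "L * H = - fps_deriv H" "\<And>n. 0 \<le> L $ n"
  shows "0 \<le> inverse H $ n"
proof (induction n rule: less_induct)
  case (less n)
  have 1: "H * inverse H = 1"
    using assms by (intro inverse_mult_eq_1') auto
  have "fps_deriv (inverse H) = - fps_deriv H * (inverse H)\<^sup>2"
    using assms by (intro fps_inverse_deriv) auto
  also have "\<dots> = L * inverse H * (H * inverse H)"
    unfolding assms(2)[symmetric] by (simp add: power2_eq_square ac_simps)
  finally have d: "fps_deriv (inverse H) = L * inverse H"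
    by (simp add: 1)
  show ?case
  proof (cases n)
    case 0
    then show ?thesis using assms by simp
  next
    case (Suc m)
    have "real n * inverse H $ n = (L * inverse H) $ m"
      unfolding d[symmetric] using Suc by simp
    also have "\<dots> \<ge> 0"
      unfolding fps_mult_nth using less.IH Suc assms(3) by (intro sum_nonneg) auto
    finally show ?thesis
      using Suc by (simp add: zero_le_mult_iff)
  qed
qed

text \<open>
  The idea is that of Pringsheim's theorem: the singularity of \<open>1 / H\<close> closest to the origin lies
  on the positive real axis.
\<close>
lemma fps_conv_radius_inverse_nonneg:
  fixes H :: "real fps"
  assumes H: "fps_conv_radius H = \<infinity>" "H $ 0 \<noteq> 0"
    and nonneg: "\<And>n. 0 \<le> inverse H $ n"
    and nz: "\<And>x. 0 \<le> x \<Longrightarrow> x < \<rho> \<Longrightarrow> eval_fps H x \<noteq> 0"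
  shows "ereal \<rho> \<le> fps_conv_radius (inverse H)"
proof (rule ccontr)
  define G where "G = inverse H"
  assume "\<not> ?thesis"
  then have less: "fps_conv_radius G < ereal \<rho>" by (simp add: G_def)
  have pos: "fps_conv_radius G > 0"
    unfolding G_def using H by (intro fps_conv_radius_inverse_pos) auto
  obtain R where R: "fps_conv_radius G = ereal R"
    using less pos by (cases "fps_conv_radius G") auto
  have R0: "0 < R" "R < \<rho>" using pos less R by auto
  have GH: "G * H = 1"
    unfolding G_def using H by (intro inverse_mult_eq_1) auto
  have cont: "continuous_on {0..R} (\<lambda>x. inverse (eval_fps H x))"
    using H nz R0 by (intro continuous_intros) auto
  obtain M where M: "\<And>x. x \<in> {0..R} \<Longrightarrow> inverse (eval_fps H x) \<le> M"
    using continuous_attains_sup[OF compact_Icc _ cont] R0 by fastforce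
  have GM: "eval_fps G x \<le> M" if "0 \<le> x" "x < R" for x
  proof -
    have "eval_fps G x * eval_fps H x = eval_fps (G * H) x"
      using that R H by (subst eval_fps_mult) auto
    then have "eval_fps G x * eval_fps H x = 1" by (simp add: GH)
    then have "eval_fps G x = inverse (eval_fps H x)"
      by (metis inverse_unique mult.commute)
    then show ?thesis using M[of x] that by simp
  qed
  have prod: "eval_fps (complex_fps G) z * eval_fps (complex_fps H) z = 1"
    if "norm z < R" for z
  proof -
    have "eval_fps (complex_fps G) z * eval_fps (complex_fps H) z
        = eval_fps (complex_fps (G * H)) z"
      unfolding complex_fps_mult using that R H by (subst eval_fps_mult) auto
    then show ?thesis by (simp add: GH complex_fps_1)
  qed
  have lower: "1 \<le> M * norm (eval_fps (complex_fps H) z)" if "norm z < R" for z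
  proof -
    have "norm (eval_fps (complex_fps G) z) \<le> M"
      using norm_eval_complex_fps_le[of G z] GM[of "norm z"] nonneg that R
      by (force simp: G_def)
    moreover have "1 = norm (eval_fps (complex_fps G) z) * norm (eval_fps (complex_fps H) z)"
      using prod[OF that] by (metis norm_mult norm_one)
    ultimately show ?thesis
      by (metis mult_right_mono norm_ge_zero)
  qed
  have contc: "continuous_on UNIV (eval_fps (complex_fps H))"
    using continuous_on_eval_fps[of "complex_fps H"] H by simp
  have lower': "1 \<le> M * norm (eval_fps (complex_fps H) z)" if "z \<in> cball 0 R" for z
  proof -
    have "closed {z. 1 \<le> M * norm (eval_fps (complex_fps H) z)}"
      using contc by (intro closed_Collect_le continuous_on_const continuous_on_mult continuous_on_norm)
    moreover have "ball 0 R \<subseteq> {z. 1 \<le> M * norm (eval_fps (complex_fps H) z)}"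
      using lower by auto
    ultimately have "closure (ball 0 R) \<subseteq> {z. 1 \<le> M * norm (eval_fps (complex_fps H) z)}"
      by (intro closure_minimal)
    then show ?thesis using that R0 by auto
  qed
  have "open {z. eval_fps (complex_fps H) z \<noteq> 0}"
    using contc by (intro open_Collect_neq continuous_on_const)
  moreover have "cball 0 R \<subseteq> {z. eval_fps (complex_fps H) z \<noteq> 0}"
    using lower' by fastforce
  ultimately obtain e where e: "e > 0" "(\<Union>x\<in>cball 0 R. ball x e) \<subseteq> {z. eval_fps (complex_fps H) z \<noteq> 0}"
    using compact_subset_open_imp_ball_epsilon_subset[of "cball (0::complex) R"]
    by (metis compact_cball)
  have "eval_fps (complex_fps H) z \<noteq> 0" if "ereal (norm z) < ereal (R + e)" for z
  proof (cases "norm z \<le> R")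
    case True
    then show ?thesis using lower'[of z] by auto
  next
    case False
    define w where "w = of_real (R / norm z) * z"
    have "norm w = R" using False R0 by (auto simp: w_def norm_mult norm_divide)
    moreover have "z - w = of_real (1 - R / norm z) * z" by (simp add: w_def algebra_simps)
    then have "norm (z - w) = \<bar>1 - R / norm z\<bar> * norm z"
      by (simp only: norm_mult norm_of_real)
    then have "norm (z - w) = norm z - R"
      using False R0 by (cases "z = 0") (auto simp: left_diff_distrib)
    ultimately have "w \<in> cball 0 R" "z \<in> ball w e"
      using that by (auto simp: dist_norm norm_minus_commute)
    then show ?thesis using e(2) by blast
  qed
  then have "min (ereal (R + e)) (fps_conv_radius (complex_fps H))
      \<le> fps_conv_radius (inverse (complex_fps H))"
    by (rule fps_conv_radius_inverse)
  then have "ereal (R + e) \<le> fps_conv_radius G"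
    unfolding complex_fps_inverse[OF H(2), symmetric] G_def by (simp add: H)
  then show False using R e by simp
qed

lemma has_real_derivative_eval_fps:
  fixes H :: "real fps"
  assumes "fps_conv_radius H = \<infinity>"
  shows "(eval_fps H has_real_derivative eval_fps (fps_deriv H) x) (at x within A)"
  using assms by (intro has_field_derivative_eval_fps) auto

lemma fps_first_zero_criterion:
  fixes H L :: "real fps"
  assumes H: "fps_conv_radius H = \<infinity>" "H $ 0 = 1"
    and L: "L * H = - fps_deriv H" "\<And>n. 0 \<le> L $ n" "0 < L $ 0"
    and \<rho>: "0 < \<rho>" "eval_fps H \<rho> = 0" "\<And>x. 0 < x \<Longrightarrow> x < \<rho> \<Longrightarrow> eval_fps H x \<noteq> 0"
  defines "q \<equiv> (\<lambda>z. 4 * z * eval_fps (complex_fps (fps_deriv H)) z / eval_fps (complex_fps H) z)"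
  obtains s where "0 < s" "s < \<rho>" "1 + q (of_real s) = 0"
    "\<And>z. norm z < s \<Longrightarrow> norm (q z) < 1"
    "\<And>x. s < x \<Longrightarrow> x < \<rho> \<Longrightarrow> 1 + q (of_real x) \<noteq> 0"
    "\<And>z. norm z < \<rho> \<Longrightarrow> eval_fps (complex_fps H) z \<noteq> 0"
proof -
  define G where "G = inverse H"
  have nz: "eval_fps H x \<noteq> 0" if "0 \<le> x" "x < \<rho>" for x
    using \<rho>(3)[of x] that H by (cases "x = 0") (auto simp: eval_fps_at_0)
  have radG: "ereal \<rho> \<le> fps_conv_radius G"
    unfolding G_def using H nz fps_inverse_nonneg_of_logderiv[OF H(2) L(1,2)]
    by (intro fps_conv_radius_inverse_nonneg) auto
  have GH: "G * H = 1"
    unfolding G_def using H by (intro inverse_mult_eq_1) auto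
  have "L = L * H * G"
    using GH by (simp add: mult.assoc mult.commute[of H])
  then have "L = - (fps_deriv H * G)"
    by (simp add: L(1))
  moreover have "fps_conv_radius (fps_deriv H) = \<infinity>"
    using fps_conv_radius_deriv[of H] H by simp
  ultimately have radL: "ereal \<rho> \<le> fps_conv_radius L"
    using fps_conv_radius_mult[of "fps_deriv H" G] radG by (auto intro: order_trans)
  have nzc: "eval_fps (complex_fps H) z \<noteq> 0" if "norm z < \<rho>" for z
  proof -
    have "ereal (norm z) < fps_conv_radius G"
      using that radG less_le_trans[of "ereal (norm z)" "ereal \<rho>"] by simp
    then have "eval_fps (complex_fps G) z * eval_fps (complex_fps H) z
        = eval_fps (complex_fps (G * H)) z"
      unfolding complex_fps_mult using H by (subst eval_fps_mult) auto
    then show ?thesis by (auto simp: GH complex_fps_1)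
  qed
  have radz: "ereal (norm z) < fps_conv_radius L" if "norm z < \<rho>" for z :: complex
    using that radL less_le_trans[of "ereal (norm z)" "ereal \<rho>"] by simp
  have radx: "ereal x < fps_conv_radius L" if "x < \<rho>" for x
    using that radL less_le_trans[of "ereal x" "ereal \<rho>"] by simp
  have q: "q z = - (4 * z * eval_fps (complex_fps L) z)" if "norm z < \<rho>" for z
  proof -
    have "eval_fps (complex_fps L) z * eval_fps (complex_fps H) z
        = eval_fps (complex_fps (L * H)) z"
      unfolding complex_fps_mult using radz[OF that] H by (subst eval_fps_mult) auto
    also have "\<dots> = - eval_fps (complex_fps (fps_deriv H)) z"
      unfolding L(1) complex_fps_uminus
      using fps_conv_radius_deriv[of H] H by (subst eval_fps_minus) auto
    finally have "eval_fps (complex_fps (fps_deriv H)) z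
        = - (eval_fps (complex_fps L) z * eval_fps (complex_fps H) z)" by simp
    then show ?thesis using nzc[OF that] by (simp add: q_def)
  qed
  have qx: "q (of_real x) = of_real (- (4 * x * eval_fps L x))" if "0 \<le> x" "x < \<rho>" for x
    using that radx[of x] by (subst q) (auto simp: eval_complex_fps_of_real)
  have mono: "x * eval_fps L x < y * eval_fps L y" if "0 \<le> x" "x < y" "y < \<rho>" for x y
  proof -
    have "0 < eval_fps L y"
      using eval_fps_real_mono[of L 0 y] L that radx[of y] by (simp add: eval_fps_at_0)
    moreover have "x * eval_fps L x \<le> x * eval_fps L y"
      using that L radx[of y] by (intro mult_left_mono eval_fps_real_mono) auto
    ultimately show ?thesis
      using that by (meson le_less_trans mult_strict_right_mono)
  qed
  \<comment> \<open>Rolle's theorem for \<open>x H(x)\<^sup>4\<close>, whose derivative is \<open>H(x)\<^sup>3 (H(x) + 4 x H'(x))\<close>\<close>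
  have "\<exists>s. 0 < s \<and> s < \<rho> \<and> eval_fps H s ^ 3 * (eval_fps H s + 4 * s * eval_fps (fps_deriv H) s) = 0"
  proof -
    let ?f = "\<lambda>x. x * eval_fps H x ^ 4"
    let ?f' = "\<lambda>x. eval_fps H x ^ 3 * (eval_fps H x + 4 * x * eval_fps (fps_deriv H) x)"
    have d: "(?f has_real_derivative ?f' x) (at x)" for x
      by (rule derivative_eq_intros has_real_derivative_eval_fps[OF H(1)] refl)+
         (simp add: algebra_simps power_numeral_reduce)
    have "\<exists>z>0. z < \<rho> \<and> (\<lambda>h. h * ?f' z) = (\<lambda>v. 0)"
    proof (rule Rolle_deriv[of 0 \<rho> ?f "\<lambda>x h. h * ?f' x"])
      show "(?f has_derivative (\<lambda>h. h * ?f' x)) (at x)" for x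
        using d[of x] by (simp add: has_field_derivative_def mult_commute_abs)
      show "continuous_on {0..\<rho>} ?f"
        using d by (intro continuous_at_imp_continuous_on) (auto intro: DERIV_isCont)
    qed (use \<rho> in auto)
    then show ?thesis by (metis mult_1)
  qed
  then obtain s where s: "0 < s" "s < \<rho>"
    "eval_fps H s + 4 * s * eval_fps (fps_deriv H) s = 0"
    using \<rho>(3) by auto
  have s1: "1 + q (of_real s) = 0"
  proof -
    have "q (of_real s) = of_real (4 * s * eval_fps (fps_deriv H) s / eval_fps H s)"
      unfolding q_def using H fps_conv_radius_deriv[of H] by (simp add: eval_complex_fps_of_real)
    also have "4 * s * eval_fps (fps_deriv H) s / eval_fps H s = -1"
      using s \<rho>(3)[of s] by (simp add: field_simps)
    finally show ?thesis by simp
  qed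
  have sL: "4 * (s * eval_fps L s) = 1"
  proof -
    have "1 - complex_of_real (4 * s * eval_fps L s) = 0"
      using s1 qx[of s] s by simp
    then show ?thesis by (simp only: right_minus_eq) (metis mult.assoc of_real_eq_1_iff)
  qed
  show ?thesis
  proof
    show "0 < s" "s < \<rho>" "1 + q (of_real s) = 0" by fact+
    show "norm (q z) < 1" if "norm z < s" for z
    proof -
      have "norm (q z) = 4 * (norm z * norm (eval_fps (complex_fps L) z))"
        using that s by (subst q) (auto simp: norm_mult)
      also have "\<dots> \<le> 4 * (norm z * eval_fps L (norm z))"
        using that s radz L by (intro mult_left_mono norm_eval_complex_fps_le) auto
      also have "\<dots> < 4 * (s * eval_fps L s)"
        using mono[of "norm z" s] that s by simp
      finally show ?thesis by (simp add: sL)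
    qed
    show "1 + q (of_real x) \<noteq> 0" if "s < x" "x < \<rho>" for x
    proof
      assume "1 + q (of_real x) = 0"
      then have "1 - complex_of_real (4 * x * eval_fps L x) = 0"
        using qx[of x] s that by simp
      then have "4 * (x * eval_fps L x) = 1"
        by (simp only: right_minus_eq) (metis mult.assoc of_real_eq_1_iff)
      then show False using mono[of s x] that s sL by simp
    qed
  qed (rule nzc)
qed

section \<open>The normalised Bessel and Dini series\<close>

text \<open>
  The sign \<open>\<epsilon> = -1\<close> belongs to \<open>J\<^sub>\<nu>\<close> and \<open>\<epsilon> = 1\<close> to \<open>I\<^sub>\<nu>\<close>; the argument of the series is
  \<open>z\<^sup>2 / 4\<close>.
\<close>
definition bessel_fps :: "real \<Rightarrow> real \<Rightarrow> real fps" where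
  "bessel_fps \<epsilon> \<nu> = Abs_fps (\<lambda>n. \<epsilon> ^ n / (fact n * pochhammer (\<nu> + 1) n))"

definition dini_fps :: "real \<Rightarrow> real \<Rightarrow> real fps" where
  "dini_fps \<epsilon> \<nu> = bessel_fps \<epsilon> \<nu> + 2 * fps_X * fps_deriv (bessel_fps \<epsilon> \<nu>)"

lemma bessel_fps_nth: "bessel_fps \<epsilon> \<nu> $ n = \<epsilon> ^ n / (fact n * pochhammer (\<nu> + 1) n)"
  by (simp add: bessel_fps_def)

lemma dini_fps_nth: "dini_fps \<epsilon> \<nu> $ n = (2 * real n + 1) * bessel_fps \<epsilon> \<nu> $ n"
  by (cases n) (auto simp: dini_fps_def mult.assoc numeral_fps_const algebra_simps)

lemma pochhammer_real_neq_0: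
  assumes "\<nu> + 1 \<notin> \<int>\<^sub>\<le>\<^sub>0"
  shows "pochhammer (\<nu> + 1) n \<noteq> (0::real)"
  using assms by (auto simp: pochhammer_eq_0_iff)

lemma bessel_fps_Suc:
  "bessel_fps \<epsilon> \<nu> $ Suc n = bessel_fps \<epsilon> \<nu> $ n * (\<epsilon> / ((real n + 1) * (real n + (\<nu> + 1))))"
  by (simp add: bessel_fps_nth pochhammer_Suc add_ac mult_ac)

lemma fps_conv_radius_bessel_fps:
  assumes "\<nu> + 1 \<notin> \<int>\<^sub>\<le>\<^sub>0" "\<epsilon> \<noteq> 0"
  shows "fps_conv_radius (bessel_fps \<epsilon> \<nu>) = \<infinity>"
  unfolding fps_conv_radius_def
proof (rule conv_radius_ratio_limit_ereal_nonzero)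
  have *: "norm (bessel_fps \<epsilon> \<nu> $ n) / norm (bessel_fps \<epsilon> \<nu> $ Suc n)
      = (real n + 1) * \<bar>real n + (\<nu> + 1)\<bar> / \<bar>\<epsilon>\<bar>" for n
  proof -
    have "bessel_fps \<epsilon> \<nu> $ n \<noteq> 0"
      using pochhammer_real_neq_0[OF assms(1), of n] assms(2) by (simp add: bessel_fps_nth)
    then show ?thesis
      by (simp add: bessel_fps_Suc abs_mult abs_divide)
  qed
  have "filterlim (\<lambda>n. (real n + 1) * \<bar>real n + (\<nu> + 1)\<bar> / \<bar>\<epsilon>\<bar>) at_top sequentially"
    using assms by real_asymp
  then show "(\<lambda>n. ereal (norm (bessel_fps \<epsilon> \<nu> $ n) / norm (bessel_fps \<epsilon> \<nu> $ Suc n))) \<longlonglongrightarrow> \<infinity>"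
    unfolding * by (simp add: tendsto_PInfty_eq_at_top)
qed simp

lemma bessel_fps_ode:
  fixes \<nu> \<epsilon> :: real
  assumes "\<nu> + 1 \<notin> \<int>\<^sub>\<le>\<^sub>0"
  defines "K \<equiv> bessel_fps \<epsilon> \<nu>"
  shows "fps_const (\<nu> + 1) * fps_deriv K + fps_X * fps_deriv (fps_deriv K) = fps_const \<epsilon> * K"
proof (rule fps_ext)
  fix n
  have p: "pochhammer (\<nu> + 1) n \<noteq> 0" "real n + (\<nu> + 1) \<noteq> 0"
    using pochhammer_real_neq_0[OF assms(1), of "Suc n"] by (auto simp: pochhammer_Suc add_ac)
  have "(fps_const (\<nu> + 1) * fps_deriv K + fps_X * fps_deriv (fps_deriv K)) $ n
      = (\<nu> + 1 + real n) * (real (Suc n) * K $ Suc n)"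
    by (cases n) (auto simp: algebra_simps)
  also have "\<dots> = \<epsilon> * K $ n"
    using p by (simp add: K_def bessel_fps_Suc add_ac)
  finally show "(fps_const (\<nu> + 1) * fps_deriv K + fps_X * fps_deriv (fps_deriv K)) $ n
      = (fps_const \<epsilon> * K) $ n" by simp
qed

lemma dini_fps_deriv:
  fixes \<nu> \<epsilon> :: real
  assumes "\<nu> + 1 \<notin> \<int>\<^sub>\<le>\<^sub>0"
  defines "K \<equiv> bessel_fps \<epsilon> \<nu>"
  shows "fps_deriv (dini_fps \<epsilon> \<nu>) = fps_const (2 * \<epsilon>) * K + fps_const (1 - 2 * \<nu>) * fps_deriv K"
proof -
  have "fps_deriv (dini_fps \<epsilon> \<nu>) = 3 * fps_deriv K + 2 * (fps_X * fps_deriv (fps_deriv K))"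
    by (simp add: dini_fps_def K_def algebra_simps)
  also have "fps_X * fps_deriv (fps_deriv K) = fps_const \<epsilon> * K - fps_const (\<nu> + 1) * fps_deriv K"
    using bessel_fps_ode[OF assms(1), of \<epsilon>] by (simp add: K_def algebra_simps)
  finally show ?thesis
    by (simp add: fps_eq_iff numeral_fps_const algebra_simps)
qed

lemma fps_conv_radius_dini_fps:
  assumes "\<nu> + 1 \<notin> \<int>\<^sub>\<le>\<^sub>0" "\<epsilon> \<noteq> 0"
  shows "fps_conv_radius (dini_fps \<epsilon> \<nu>) = \<infinity>"
proof -
  have K: "fps_conv_radius (bessel_fps \<epsilon> \<nu>) = \<infinity>"
    by (rule fps_conv_radius_bessel_fps[OF assms])
  then have K': "fps_conv_radius (fps_deriv (bessel_fps \<epsilon> \<nu>)) = \<infinity>"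
    using fps_conv_radius_deriv[of "bessel_fps \<epsilon> \<nu>"] by simp
  have "fps_conv_radius (2 * fps_X :: real fps) = \<infinity>"
    using fps_conv_radius_mult[of 2 "fps_X :: real fps"] by simp
  then have "fps_conv_radius (2 * fps_X * fps_deriv (bessel_fps \<epsilon> \<nu>)) = \<infinity>"
    using fps_conv_radius_mult[of "2 * fps_X" "fps_deriv (bessel_fps \<epsilon> \<nu>)"] K' by simp
  then show ?thesis
    using fps_conv_radius_add[of "bessel_fps \<epsilon> \<nu>" "2 * fps_X * fps_deriv (bessel_fps \<epsilon> \<nu>)"] K
    by (simp add: dini_fps_def)
qed

definition bessel_fun :: "real \<Rightarrow> real \<Rightarrow> complex \<Rightarrow> complex" where
  "bessel_fun \<epsilon> \<nu> = eval_fps (complex_fps (bessel_fps \<epsilon> \<nu>))"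

definition bessel_fun' :: "real \<Rightarrow> real \<Rightarrow> complex \<Rightarrow> complex" where
  "bessel_fun' \<epsilon> \<nu> = eval_fps (complex_fps (fps_deriv (bessel_fps \<epsilon> \<nu>)))"

definition dini_fun :: "real \<Rightarrow> real \<Rightarrow> complex \<Rightarrow> complex" where
  "dini_fun \<epsilon> \<nu> = eval_fps (complex_fps (dini_fps \<epsilon> \<nu>))"

definition dini_fun' :: "real \<Rightarrow> real \<Rightarrow> complex \<Rightarrow> complex" where
  "dini_fun' \<epsilon> \<nu> = eval_fps (complex_fps (fps_deriv (dini_fps \<epsilon> \<nu>)))"

lemma bessel_fun_sums:
  assumes "\<nu> + 1 \<notin> \<int>\<^sub>\<le>\<^sub>0" "\<epsilon> \<noteq> 0"
  shows "(\<lambda>n. of_real (\<epsilon> ^ n / (fact n * pochhammer (\<nu> + 1) n)) * t ^ n) sums bessel_fun \<epsilon> \<nu> t"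
  using sums_eval_fps[of t "complex_fps (bessel_fps \<epsilon> \<nu>)"] fps_conv_radius_bessel_fps[OF assms]
  by (simp add: bessel_fun_def bessel_fps_nth)

lemma has_field_derivative_bessel_fun:
  assumes "\<nu> + 1 \<notin> \<int>\<^sub>\<le>\<^sub>0" "\<epsilon> \<noteq> 0"
  shows "(bessel_fun \<epsilon> \<nu> has_field_derivative bessel_fun' \<epsilon> \<nu> t) (at t within A)"
  unfolding bessel_fun_def bessel_fun'_def complex_fps_deriv
  using fps_conv_radius_bessel_fps[OF assms] by (intro has_field_derivative_eval_fps) auto

lemma has_field_derivative_dini_fun:
  assumes "\<nu> + 1 \<notin> \<int>\<^sub>\<le>\<^sub>0" "\<epsilon> \<noteq> 0"
  shows "(dini_fun \<epsilon> \<nu> has_field_derivative dini_fun' \<epsilon> \<nu> t) (at t within A)"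
  unfolding dini_fun_def dini_fun'_def complex_fps_deriv
  using fps_conv_radius_dini_fps[OF assms] by (intro has_field_derivative_eval_fps) auto

lemma dini_fun_eq:
  assumes "\<nu> + 1 \<notin> \<int>\<^sub>\<le>\<^sub>0" "\<epsilon> \<noteq> 0"
  shows "dini_fun \<epsilon> \<nu> t = bessel_fun \<epsilon> \<nu> t + 2 * t * bessel_fun' \<epsilon> \<nu> t"
proof -
  let ?K = "complex_fps (bessel_fps \<epsilon> \<nu>)"
  have r: "fps_conv_radius ?K = \<infinity>" "fps_conv_radius (fps_deriv ?K) = \<infinity>"
    using fps_conv_radius_bessel_fps[OF assms] fps_conv_radius_deriv[of ?K] by auto
  have "complex_fps (dini_fps \<epsilon> \<nu>) = ?K + fps_const 2 * (fps_X * fps_deriv ?K)"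
    by (simp add: fps_eq_iff dini_fps_def mult.assoc numeral_fps_const)
  moreover have "fps_conv_radius (fps_X * fps_deriv ?K) = \<infinity>"
    using fps_conv_radius_mult[of fps_X "fps_deriv ?K"] r by simp
  moreover from this have "fps_conv_radius (fps_const 2 * (fps_X * fps_deriv ?K)) = \<infinity>"
    by (subst fps_conv_radius_cmult_left) auto
  ultimately show ?thesis
    unfolding dini_fun_def bessel_fun_def bessel_fun'_def complex_fps_deriv
    using r by (simp add: eval_fps_add eval_fps_mult)
qed

lemma dini_fun'_eq:
  assumes "\<nu> + 1 \<notin> \<int>\<^sub>\<le>\<^sub>0" "\<epsilon> \<noteq> 0"
  shows "dini_fun' \<epsilon> \<nu> t
      = of_real (2 * \<epsilon>) * bessel_fun \<epsilon> \<nu> t + of_real (1 - 2 * \<nu>) * bessel_fun' \<epsilon> \<nu> t"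
proof -
  let ?K = "complex_fps (bessel_fps \<epsilon> \<nu>)"
  let ?a = "fps_const (of_real (2 * \<epsilon>))" and ?b = "fps_const (of_real (1 - 2 * \<nu>))"
  have r: "fps_conv_radius ?K = \<infinity>" "fps_conv_radius (fps_deriv ?K) = \<infinity>"
    using fps_conv_radius_bessel_fps[OF assms] fps_conv_radius_deriv[of ?K] by auto
  have "complex_fps (fps_deriv (dini_fps \<epsilon> \<nu>)) = ?a * ?K + ?b * fps_deriv ?K"
    unfolding dini_fps_deriv[OF assms(1)] by (simp add: fps_eq_iff)
  moreover have "fps_conv_radius (?a * ?K) = \<infinity>" "fps_conv_radius (?b * fps_deriv ?K) = \<infinity>"
    using fps_conv_radius_mult[of ?a ?K] fps_conv_radius_mult[of ?b "fps_deriv ?K"] r by auto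
  ultimately show ?thesis
    unfolding dini_fun'_def bessel_fun_def bessel_fun'_def complex_fps_deriv
    using r by (simp add: eval_fps_add eval_fps_mult)
qed

lemma rpow_nonzero: "z \<noteq> 0 \<Longrightarrow> rpow z s = z powr of_real s"
  by (simp add: rpow_def)

lemma bessel_series:
  assumes "\<nu> + 1 \<notin> \<int>\<^sub>\<le>\<^sub>0" "\<epsilon> \<noteq> 0" "z \<noteq> 0"
  shows "(\<Sum>n. of_real \<epsilon> ^ n * of_real (rGamma (real n + \<nu> + 1)) / fact n * rpow (z / 2) (2 * real n + \<nu>))
       = (z / 2) powr of_real \<nu> * of_real (rGamma (\<nu> + 1)) * bessel_fun \<epsilon> \<nu> (z\<^sup>2 / 4)"
proof -
  define c where "c = (z / 2) powr of_real \<nu> * complex_of_real (rGamma (\<nu> + 1))"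
  have "of_real \<epsilon> ^ n * of_real (rGamma (real n + \<nu> + 1)) / fact n * rpow (z / 2) (2 * real n + \<nu>)
      = c * (of_real (\<epsilon> ^ n / (fact n * pochhammer (\<nu> + 1) n)) * (z\<^sup>2 / 4) ^ n)" for n
  proof -
    have "rGamma (\<nu> + 1) = pochhammer (\<nu> + 1) n * rGamma (real n + \<nu> + 1)"
      using pochhammer_rGamma[of "\<nu> + 1" n] by (simp add: add_ac)
    then have 1: "rGamma (real n + \<nu> + 1) = rGamma (\<nu> + 1) / pochhammer (\<nu> + 1) n"
      using pochhammer_real_neq_0[OF assms(1), of n] by simp
    have "rpow (z / 2) (2 * real n + \<nu>) = (z / 2) powr of_real \<nu> * (z / 2) powr of_nat (2 * n)"
      using assms by (simp add: rpow_nonzero powr_add mult.commute)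
    also have "(z / 2) powr of_nat (2 * n) = (z\<^sup>2 / 4) ^ n"
      using assms by (subst powr_nat') (auto simp: power_mult power_divide)
    finally show ?thesis
      by (simp add: 1 c_def mult_ac)
  qed
  then show ?thesis
    unfolding c_def[symmetric]
    using sums_mult[OF bessel_fun_sums[OF assms(1,2), of "z\<^sup>2 / 4"], of c] by (simp add: sums_iff)
qed

lemma bessel_fun_shift:
  assumes "\<nu> + 1 \<notin> \<int>\<^sub>\<le>\<^sub>0" "\<epsilon> \<noteq> 0"
  shows "bessel_fun' \<epsilon> \<nu> t = of_real (\<epsilon> / (\<nu> + 1)) * bessel_fun \<epsilon> (\<nu> + 1) t"
proof -
  have "fps_deriv (bessel_fps \<epsilon> \<nu>) $ n = \<epsilon> / (\<nu> + 1) * bessel_fps \<epsilon> (\<nu> + 1) $ n" for n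
    by (simp add: bessel_fps_nth pochhammer_rec add_ac mult_ac del: of_nat_Suc)
  then have "complex_fps (fps_deriv (bessel_fps \<epsilon> \<nu>))
      = fps_const (of_real (\<epsilon> / (\<nu> + 1))) * complex_fps (bessel_fps \<epsilon> (\<nu> + 1))"
    by (simp add: fps_eq_iff)
  moreover have "\<nu> + 1 + 1 \<notin> \<int>\<^sub>\<le>\<^sub>0"
    using assms(1) plus_one_in_nonpos_Ints_imp by blast
  ultimately show ?thesis
    unfolding bessel_fun'_def bessel_fun_def
    using fps_conv_radius_bessel_fps[of "\<nu> + 1" \<epsilon>] assms by (simp add: eval_fps_mult)
qed

lemma bessel_series_Suc:
  assumes "\<nu> + 1 \<notin> \<int>\<^sub>\<le>\<^sub>0" "\<epsilon> \<noteq> 0" "z \<noteq> 0"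
  shows "of_real \<epsilon> * (\<Sum>n. of_real \<epsilon> ^ n * of_real (rGamma (real n + (\<nu> + 1) + 1)) / fact n
           * rpow (z / 2) (2 * real n + (\<nu> + 1)))
       = (z / 2) powr of_real \<nu> * of_real (rGamma (\<nu> + 1)) * (z / 2) * bessel_fun' \<epsilon> \<nu> (z\<^sup>2 / 4)"
proof -
  have 1: "\<nu> + 1 + 1 \<notin> \<int>\<^sub>\<le>\<^sub>0"
    using assms(1) plus_one_in_nonpos_Ints_imp by blast
  have "\<nu> + 1 \<noteq> 0" using assms(1) by auto
  then have 2: "rGamma (\<nu> + 1 + 1) = rGamma (\<nu> + 1) / (\<nu> + 1)"
    using rGamma_plus1[of "\<nu> + 1"] by (simp add: field_simps)
  have 3: "(z / 2) powr of_real (\<nu> + 1) = (z / 2) powr of_real \<nu> * (z / 2)"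
    using assms(3) powr_nat'[of "z / 2" 1] by (simp add: powr_add)
  show ?thesis
    unfolding bessel_series[OF 1 assms(2,3)] bessel_fun_shift[OF assms(1,2)] 2 3 by simp
qed

lemma bessel_J_eq:
  assumes "\<nu> + 1 \<notin> \<int>\<^sub>\<le>\<^sub>0" "z \<noteq> 0"
  shows "bessel_J \<nu> z = (z / 2) powr of_real \<nu> * of_real (rGamma (\<nu> + 1)) * bessel_fun (-1) \<nu> (z\<^sup>2 / 4)"
  using bessel_series[OF assms(1) _ assms(2), of "-1"] by (simp add: bessel_J_def)

lemma bessel_J_Suc_eq:
  assumes "\<nu> + 1 \<notin> \<int>\<^sub>\<le>\<^sub>0" "z \<noteq> 0"
  shows "bessel_J (\<nu> + 1) z
       = - ((z / 2) powr of_real \<nu> * of_real (rGamma (\<nu> + 1)) * (z / 2) * bessel_fun' (-1) \<nu> (z\<^sup>2 / 4))"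
proof -
  have "- bessel_J (\<nu> + 1) z
      = (z / 2) powr of_real \<nu> * of_real (rGamma (\<nu> + 1)) * (z / 2) * bessel_fun' (-1) \<nu> (z\<^sup>2 / 4)"
    using bessel_series_Suc[OF assms(1) _ assms(2), of "-1"] by (simp add: bessel_J_def)
  then show ?thesis by (metis add.inverse_inverse)
qed

lemma bessel_I_eq:
  assumes "\<nu> + 1 \<notin> \<int>\<^sub>\<le>\<^sub>0" "z \<noteq> 0"
  shows "bessel_I \<nu> z = (z / 2) powr of_real \<nu> * of_real (rGamma (\<nu> + 1)) * bessel_fun 1 \<nu> (z\<^sup>2 / 4)"
  using bessel_series[OF assms(1) _ assms(2), of 1] by (simp add: bessel_I_def)

lemma bessel_I_Suc_eq:
  assumes "\<nu> + 1 \<notin> \<int>\<^sub>\<le>\<^sub>0" "z \<noteq> 0"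
  shows "bessel_I (\<nu> + 1) z
       = (z / 2) powr of_real \<nu> * of_real (rGamma (\<nu> + 1)) * (z / 2) * bessel_fun' 1 \<nu> (z\<^sup>2 / 4)"
  using bessel_series_Suc[OF assms(1) _ assms(2), of 1] by (simp add: bessel_I_def)

definition dini_quot :: "real \<Rightarrow> real \<Rightarrow> complex \<Rightarrow> complex" where
  "dini_quot \<epsilon> \<nu> t = 4 * t * dini_fun' \<epsilon> \<nu> t / dini_fun \<epsilon> \<nu> t"

lemma rGamma_nonzero:
  assumes "\<nu> + 1 \<notin> \<int>\<^sub>\<le>\<^sub>0"
  shows "rGamma (\<nu> + 1) \<noteq> (0::real)"
  using assms rGamma_eq_zero_iff by blast

lemma uc_eq_J_eq:
  assumes "\<nu> + 1 \<notin> \<int>\<^sub>\<le>\<^sub>0" "z \<noteq> 0"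
  shows "uc_eq_J \<nu> z = 1 + dini_quot (-1) \<nu> (z\<^sup>2 / 4)"
proof -
  define c where "c = (z / 2) powr of_real \<nu> * complex_of_real (rGamma (\<nu> + 1))"
  have c: "c \<noteq> 0" using assms rGamma_nonzero by (simp add: c_def)
  have num: "of_real (2 * \<nu> - 1) * bessel_J (\<nu> + 1) z - z * bessel_J \<nu> z
      = c * (z / 2 * dini_fun' (-1) \<nu> (z\<^sup>2 / 4))"
    unfolding bessel_J_eq[OF assms] bessel_J_Suc_eq[OF assms] dini_fun'_eq[OF assms(1), of "-1", simplified]
      c_def[symmetric]
    by (simp add: field_simps)
  have den: "bessel_J \<nu> z - z * bessel_J (\<nu> + 1) z = c * dini_fun (-1) \<nu> (z\<^sup>2 / 4)"
    unfolding bessel_J_eq[OF assms] bessel_J_Suc_eq[OF assms] dini_fun_eq[OF assms(1), of "-1", simplified]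
      c_def[symmetric]
    by (simp add: algebra_simps power2_eq_square)
  show ?thesis
    unfolding uc_eq_J_def num den dini_quot_def using c by (simp add: power2_eq_square)
qed

lemma uc_eq_I_eq:
  assumes "\<nu> + 1 \<notin> \<int>\<^sub>\<le>\<^sub>0" "z \<noteq> 0"
  shows "uc_eq_I \<nu> z = 1 + dini_quot 1 \<nu> (z\<^sup>2 / 4)"
proof -
  define c where "c = (z / 2) powr of_real \<nu> * complex_of_real (rGamma (\<nu> + 1))"
  have c: "c \<noteq> 0" using assms rGamma_nonzero by (simp add: c_def)
  have num: "z * bessel_I \<nu> z - of_real (2 * \<nu> - 1) * bessel_I (\<nu> + 1) z
      = c * (z / 2 * dini_fun' 1 \<nu> (z\<^sup>2 / 4))"
    unfolding bessel_I_eq[OF assms] bessel_I_Suc_eq[OF assms] dini_fun'_eq[OF assms(1), of 1, simplified]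
      c_def[symmetric]
    by (simp add: field_simps)
  have den: "bessel_I \<nu> z + z * bessel_I (\<nu> + 1) z = c * dini_fun 1 \<nu> (z\<^sup>2 / 4)"
    unfolding bessel_I_eq[OF assms] bessel_I_Suc_eq[OF assms] dini_fun_eq[OF assms(1), of 1, simplified]
      c_def[symmetric]
    by (simp add: algebra_simps power2_eq_square)
  show ?thesis
    unfolding uc_eq_I_def num den dini_quot_def using c by (simp add: power2_eq_square)
qed

lemma has_field_derivative_compose_square:
  fixes F :: "complex \<Rightarrow> complex"
  assumes "(F has_field_derivative D) (at (z\<^sup>2 / 4))"
  shows "((\<lambda>z. F (z\<^sup>2 / 4)) has_field_derivative z / 2 * D) (at z)"
proof -
  have "((\<lambda>z. z\<^sup>2 / 4) has_field_derivative z / 2) (at z)"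
    by (auto intro!: derivative_eq_intros)
  from DERIV_chain2[OF assms this] show ?thesis by (simp add: mult.commute)
qed

lemma dini_eq:
  assumes "\<nu> + 1 \<notin> \<int>\<^sub>\<le>\<^sub>0" "z \<notin> \<real>\<^sub>\<le>\<^sub>0"
  shows "dini \<nu> z = (z / 2) powr of_real \<nu> * of_real (rGamma (\<nu> + 1)) * dini_fun (-1) \<nu> (z\<^sup>2 / 4)"
proof -
  have z: "z \<noteq> 0" "z / 2 \<notin> \<real>\<^sub>\<le>\<^sub>0"
    using assms(2) by (auto simp: complex_nonpos_Reals_iff)
  let ?r = "complex_of_real (rGamma (\<nu> + 1))" and ?p = "(z / 2) powr of_real \<nu>"
  let ?J = "\<lambda>z. (z / 2) powr of_real \<nu> * ?r * bessel_fun (-1) \<nu> (z\<^sup>2 / 4)"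
  let ?J' = "of_real \<nu> / z * ?p * ?r * bessel_fun (-1) \<nu> (z\<^sup>2 / 4)
      + z / 2 * bessel_fun' (-1) \<nu> (z\<^sup>2 / 4) * (?p * ?r)"
  have half: "((\<lambda>z. z / 2) has_field_derivative 1 / 2) (at z)"
    by (auto intro!: derivative_eq_intros)
  have "((\<lambda>z. (z / 2) powr of_real \<nu>) has_field_derivative
      of_real \<nu> * (z / 2) powr (of_real \<nu> - 1) * (1 / 2)) (at z)"
    by (rule DERIV_chain2[OF has_field_derivative_powr[OF z(2)] half])
  also have "of_real \<nu> * (z / 2) powr (of_real \<nu> - 1) * (1 / 2) = of_real \<nu> / z * ?p"
    using z(1) powr_nat'[of "z / 2" 1] by (simp add: powr_diff)
  finally have p: "((\<lambda>z. (z / 2) powr of_real \<nu>) has_field_derivative of_real \<nu> / z * ?p) (at z)" .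
  have "((\<lambda>z. bessel_fun (-1) \<nu> (z\<^sup>2 / 4)) has_field_derivative z / 2 * bessel_fun' (-1) \<nu> (z\<^sup>2 / 4)) (at z)"
    using assms(1) by (intro has_field_derivative_compose_square has_field_derivative_bessel_fun) auto
  with DERIV_cmult_right[OF p, of ?r]
  have "(?J has_field_derivative ?J') (at z)"
    by (rule DERIV_mult)
  then have "deriv ?J z = ?J'" by (rule DERIV_imp_deriv)
  moreover have "\<forall>\<^sub>F w in nhds z. bessel_J \<nu> w = ?J w"
    using t1_space_nhds[OF z(1)] by eventually_elim (rule bessel_J_eq[OF assms(1)])
  then have "deriv (bessel_J \<nu>) z = deriv ?J z"
    by (rule deriv_cong_ev) simp
  ultimately have "dini \<nu> z = of_real (1 - \<nu>) * ?J z + z * ?J'"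
    by (simp only: dini_def bessel_J_eq[OF assms(1) z(1)])
  also have "z * ?J' = of_real \<nu> * ?J z + z * (z / 2 * bessel_fun' (-1) \<nu> (z\<^sup>2 / 4) * (?p * ?r))"
    using z(1) by (simp add: distrib_left)
  also have "of_real (1 - \<nu>) * ?J z + \<dots> = ?p * ?r * dini_fun (-1) \<nu> (z\<^sup>2 / 4)"
    unfolding dini_fun_eq[OF assms(1), of "-1", simplified]
    by (simp add: algebra_simps power2_eq_square)
  finally show ?thesis .
qed

lemma bessel_g_eq:
  assumes "\<nu> + 1 \<notin> \<int>\<^sub>\<le>\<^sub>0"
  shows "bessel_g \<nu> z = z * bessel_fun (-1) \<nu> (z\<^sup>2 / 4)"
proof (cases "z = 0")
  case True
  have "rpow 0 (2 * real n + 1) = 0" for n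
    by (simp add: rpow_def)
  then show ?thesis
    using True by (cases "\<nu> = 1") (auto simp: bessel_g_def bessel_J_def rpow_def)
next
  case False
  have "of_real (2 powr \<nu>) * (z powr (1 - of_real \<nu>) * (z / 2) powr of_real \<nu>) = z"
  proof -
    have "(z / 2) powr of_real \<nu> = (1 / 2) powr of_real \<nu> * z powr of_real \<nu>"
      using powr_times_real_left[of "1 / 2" z "of_real \<nu>"] by simp
    also have "(1 / 2) powr of_real \<nu> = complex_of_real ((1 / 2) powr \<nu>)"
      using powr_of_real[of "1 / 2" \<nu>] by simp
    finally have "of_real (2 powr \<nu>) * (z powr (1 - of_real \<nu>) * (z / 2) powr of_real \<nu>)
        = of_real (2 powr \<nu> * (1 / 2) powr \<nu>) * (z powr (1 - of_real \<nu>) * z powr of_real \<nu>)"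
      by (simp add: mult_ac)
    also have "2 powr \<nu> * (1 / 2) powr \<nu> = (1 :: real)"
      by (simp flip: powr_mult)
    also have "z powr (1 - of_real \<nu>) * z powr of_real \<nu> = z"
      using False powr_nat'[of z 1] by (simp flip: powr_add)
    finally show ?thesis by simp
  qed
  moreover have "Gamma (\<nu> + 1) * rGamma (\<nu> + 1) = 1"
    using rGamma_nonzero[OF assms] by (simp add: rGamma_inverse_Gamma)
  then have "complex_of_real (Gamma (\<nu> + 1)) * complex_of_real (rGamma (\<nu> + 1)) = 1"
    by (metis of_real_1 of_real_mult)
  ultimately have "of_real (2 powr \<nu>) * (z powr (1 - of_real \<nu>) * (z / 2) powr of_real \<nu>)
      * (complex_of_real (Gamma (\<nu> + 1)) * complex_of_real (rGamma (\<nu> + 1))) * bessel_fun (-1) \<nu> (z\<^sup>2 / 4)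
      = z * bessel_fun (-1) \<nu> (z\<^sup>2 / 4)" by simp
  then show ?thesis
    using False by (simp add: bessel_g_def bessel_J_eq[OF assms False] rpow_nonzero mult_ac)
qed

lemma deriv_bessel_g:
  assumes "\<nu> + 1 \<notin> \<int>\<^sub>\<le>\<^sub>0"
  shows "deriv (bessel_g \<nu>) = (\<lambda>z. dini_fun (-1) \<nu> (z\<^sup>2 / 4))"
    and "deriv (deriv (bessel_g \<nu>)) = (\<lambda>z. z / 2 * dini_fun' (-1) \<nu> (z\<^sup>2 / 4))"
    and "bessel_g \<nu> holomorphic_on UNIV"
proof -
  have d: "((\<lambda>z. z * bessel_fun (-1) \<nu> (z\<^sup>2 / 4)) has_field_derivative dini_fun (-1) \<nu> (z\<^sup>2 / 4)) (at z)" for z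
  proof -
    have "((\<lambda>z. bessel_fun (-1) \<nu> (z\<^sup>2 / 4)) has_field_derivative z / 2 * bessel_fun' (-1) \<nu> (z\<^sup>2 / 4)) (at z)"
      using assms by (intro has_field_derivative_compose_square has_field_derivative_bessel_fun) auto
    from DERIV_mult[OF DERIV_ident this] show ?thesis
      unfolding dini_fun_eq[OF assms, of "-1", simplified]
      by (simp add: power2_eq_square algebra_simps)
  qed
  have g: "bessel_g \<nu> = (\<lambda>z. z * bessel_fun (-1) \<nu> (z\<^sup>2 / 4))"
    using bessel_g_eq[OF assms] by auto
  show 1: "deriv (bessel_g \<nu>) = (\<lambda>z. dini_fun (-1) \<nu> (z\<^sup>2 / 4))"
    unfolding g using d DERIV_imp_deriv by blast
  show "bessel_g \<nu> holomorphic_on UNIV"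
    unfolding g using d by (subst holomorphic_on_open) auto
  have "((\<lambda>z. dini_fun (-1) \<nu> (z\<^sup>2 / 4)) has_field_derivative z / 2 * dini_fun' (-1) \<nu> (z\<^sup>2 / 4)) (at z)" for z
    using assms by (intro has_field_derivative_compose_square has_field_derivative_dini_fun) auto
  then show "deriv (deriv (bessel_g \<nu>)) = (\<lambda>z. z / 2 * dini_fun' (-1) \<nu> (z\<^sup>2 / 4))"
    unfolding 1 using DERIV_imp_deriv by blast
qed

lemma radius_uniform_convexity_bessel_g:
  assumes \<nu>: "\<nu> + 1 \<notin> \<int>\<^sub>\<le>\<^sub>0" and s: "0 < s"
    and less: "\<And>t. norm t < s \<Longrightarrow> dini_fun (-1) \<nu> t \<noteq> 0"
      "\<And>t. norm t < s \<Longrightarrow> norm (dini_quot (-1) \<nu> t) < 1"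
    and t0: "norm t0 = s" "1 + dini_quot (-1) \<nu> t0 = 0"
  shows "radius_uniform_convexity (bessel_g \<nu>) = ereal (2 * sqrt s)"
proof -
  note d = deriv_bessel_g[OF \<nu>]
  define S where "S = {ereal r | r. 0 < r \<and> ereal r < fps_conv_radius (fps_expansion (bessel_g \<nu>) 0) \<and>
       (\<forall>z\<in>ball 0 r. deriv (bessel_g \<nu>) z \<noteq> 0 \<and>
          Re (1 + z * deriv (deriv (bessel_g \<nu>)) z / deriv (bessel_g \<nu>) z)
            > norm (z * deriv (deriv (bessel_g \<nu>)) z / deriv (bessel_g \<nu>) z))}"
  have rad: "fps_conv_radius (fps_expansion (bessel_g \<nu>) 0) = \<infinity>"
    using conv_radius_fps_expansion[of "bessel_g \<nu>" 0 \<infinity>] d(3) by simp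
  have q: "z * deriv (deriv (bessel_g \<nu>)) z / deriv (bessel_g \<nu>) z = dini_quot (-1) \<nu> (z\<^sup>2 / 4) / 2" for z
    unfolding d(2) unfolding d(1) dini_quot_def by (simp add: power2_eq_square mult_ac)
  have "Sup S = ereal (2 * sqrt s)"
  proof (rule Sup_eqI)
    fix y assume "y \<in> S"
    then obtain r where r: "y = ereal r"
      "\<forall>z\<in>ball 0 r. Re (1 + dini_quot (-1) \<nu> (z\<^sup>2 / 4) / 2) > norm (dini_quot (-1) \<nu> (z\<^sup>2 / 4) / 2)"
      unfolding S_def q by auto
    define z where "z = 2 * csqrt t0"
    have "z\<^sup>2 / 4 = t0" by (simp add: z_def power_mult_distrib)
    moreover have "dini_quot (-1) \<nu> t0 = -1"
      using t0(2) by (simp add: add_eq_0_iff)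
    ultimately have "z \<notin> ball 0 r" using r(2) by fastforce
    then have "r \<le> norm z" by simp
    also have "norm z = 2 * sqrt s" by (simp add: z_def norm_mult t0)
    finally show "y \<le> ereal (2 * sqrt s)" using r by simp
  next
    fix y assume y: "\<And>x. x \<in> S \<Longrightarrow> x \<le> y"
    have "ereal (2 * sqrt s) \<in> S"
      unfolding S_def q
    proof (intro CollectI exI conjI ballI)
      fix z :: complex assume "z \<in> ball 0 (2 * sqrt s)"
      then have "norm z < 2 * sqrt s" by simp
      then have "(norm z)\<^sup>2 < (2 * sqrt s)\<^sup>2" by (intro power_strict_mono) auto
      then have n: "norm (z\<^sup>2 / 4) < s"
        using s by (simp add: norm_divide norm_power power_mult_distrib)
      show "deriv (bessel_g \<nu>) z \<noteq> 0" using less(1)[OF n] by (simp add: d)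
      have "- Re (dini_quot (-1) \<nu> (z\<^sup>2 / 4)) \<le> norm (dini_quot (-1) \<nu> (z\<^sup>2 / 4))"
        using abs_Re_le_cmod[of "dini_quot (-1) \<nu> (z\<^sup>2 / 4)"] by linarith
      then show "norm (dini_quot (-1) \<nu> (z\<^sup>2 / 4) / 2) < Re (1 + dini_quot (-1) \<nu> (z\<^sup>2 / 4) / 2)"
        using less(2)[OF n] by (simp add: norm_divide)
    qed (use s rad in auto)
    then show "ereal (2 * sqrt s) \<le> y" using y by blast
  qed
  then show ?thesis by (simp add: radius_uniform_convexity_def S_def)
qed

lemma dini_fun_uminus:
  assumes "\<nu> + 1 \<notin> \<int>\<^sub>\<le>\<^sub>0" "\<epsilon> \<noteq> 0"
  shows "dini_fun (- \<epsilon>) \<nu> t = dini_fun \<epsilon> \<nu> (- t)" "dini_quot (- \<epsilon>) \<nu> t = dini_quot \<epsilon> \<nu> (- t)"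
proof -
  have e: "dini_fun (- \<epsilon>) \<nu> t = dini_fun \<epsilon> \<nu> (- t)" for t
    unfolding dini_fun_def eval_fps_def
    by (intro suminf_cong) (simp add: dini_fps_nth bessel_fps_nth power_minus[of t] power_minus[of \<epsilon>]
        power_minus[of "of_real \<epsilon>"])
  have "((\<lambda>t. dini_fun \<epsilon> \<nu> (- t)) has_field_derivative dini_fun' \<epsilon> \<nu> (- t) * -1) (at t)"
    by (rule DERIV_chain2[OF has_field_derivative_dini_fun[OF assms]]) (auto intro!: derivative_eq_intros)
  moreover have "((\<lambda>t. dini_fun \<epsilon> \<nu> (- t)) has_field_derivative dini_fun' (- \<epsilon>) \<nu> t) (at t)"
    unfolding e[symmetric] using has_field_derivative_dini_fun[of \<nu> "- \<epsilon>"] assms by simp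
  ultimately have "dini_fun' (- \<epsilon>) \<nu> t = - dini_fun' \<epsilon> \<nu> (- t)"
    using DERIV_unique by fastforce
  then show "dini_quot (- \<epsilon>) \<nu> t = dini_quot \<epsilon> \<nu> (- t)"
    by (simp add: dini_quot_def e)
  show "dini_fun (- \<epsilon>) \<nu> t = dini_fun \<epsilon> \<nu> (- t)" by (rule e)
qed

lemma dini_fun_of_real:
  assumes "\<nu> + 1 \<notin> \<int>\<^sub>\<le>\<^sub>0" "\<epsilon> \<noteq> 0"
  shows "dini_fun \<epsilon> \<nu> (of_real x) = of_real (eval_fps (dini_fps \<epsilon> \<nu>) x)"
  using fps_conv_radius_dini_fps[OF assms] by (simp add: dini_fun_def eval_complex_fps_of_real)

lemma dini_criterion:
  assumes \<nu>: "\<nu> + 1 \<notin> \<int>\<^sub>\<le>\<^sub>0" "\<epsilon> \<noteq> 0"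
    and L: "L * dini_fps \<epsilon> \<nu> = - fps_deriv (dini_fps \<epsilon> \<nu>)" "\<And>n. 0 \<le> L $ n" "0 < L $ 0"
    and \<rho>: "0 < \<rho>" "eval_fps (dini_fps \<epsilon> \<nu>) \<rho> = 0"
      "\<And>x. 0 < x \<Longrightarrow> x < \<rho> \<Longrightarrow> eval_fps (dini_fps \<epsilon> \<nu>) x \<noteq> 0"
  obtains s where "0 < s" "s < \<rho>" "1 + dini_quot \<epsilon> \<nu> (of_real s) = 0"
    "\<And>t. norm t < s \<Longrightarrow> norm (dini_quot \<epsilon> \<nu> t) < 1"
    "\<And>t. norm t < s \<Longrightarrow> dini_fun \<epsilon> \<nu> t \<noteq> 0"
    "\<And>x. 0 < x \<Longrightarrow> x < \<rho> \<Longrightarrow> 1 + dini_quot \<epsilon> \<nu> (of_real x) = 0 \<longleftrightarrow> x = s"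
proof -
  have H: "fps_conv_radius (dini_fps \<epsilon> \<nu>) = \<infinity>" "dini_fps \<epsilon> \<nu> $ 0 = 1"
    using \<nu> by (simp_all add: fps_conv_radius_dini_fps dini_fps_nth bessel_fps_nth)
  obtain s where s: "0 < s" "s < \<rho>" "1 + dini_quot \<epsilon> \<nu> (of_real s) = 0"
    "\<And>t. norm t < s \<Longrightarrow> norm (dini_quot \<epsilon> \<nu> t) < 1"
    "\<And>x. s < x \<Longrightarrow> x < \<rho> \<Longrightarrow> 1 + dini_quot \<epsilon> \<nu> (of_real x) \<noteq> 0"
    "\<And>t. norm t < \<rho> \<Longrightarrow> dini_fun \<epsilon> \<nu> t \<noteq> 0"
    using fps_first_zero_criterion[OF H L \<rho>]
    unfolding dini_quot_def dini_fun_def dini_fun'_def by blast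
  show ?thesis
  proof
    show "1 + dini_quot \<epsilon> \<nu> (of_real x) = 0 \<longleftrightarrow> x = s" if "0 < x" "x < \<rho>" for x
    proof (cases x s rule: linorder_cases)
      case less
      then have "norm (dini_quot \<epsilon> \<nu> (of_real x)) < 1" using s(4) that by simp
      then have "1 + dini_quot \<epsilon> \<nu> (of_real x) \<noteq> 0"
        by (metis add_eq_0_iff less_irrefl norm_minus_cancel norm_one)
      then show ?thesis using less by simp
    qed (use s that in auto)
    show "dini_fun \<epsilon> \<nu> t \<noteq> 0" if "norm t < s" for t
      using s(2) s(6)[of t] that by simp
  qed (use s in auto)
qed

section \<open>Rayleigh sums\<close>

context
  fixes \<nu> :: real and Y :: "real fps"
  assumes \<nu>: "- 1 < \<nu>"
  defines "Y \<equiv> - fps_deriv (bessel_fps (-1) \<nu>) * inverse (bessel_fps (-1) \<nu>)"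
begin

private abbreviation "K \<equiv> bessel_fps (-1) \<nu>"

private lemma K: "\<nu> + 1 \<notin> \<int>\<^sub>\<le>\<^sub>0" "K $ 0 = 1" "K \<noteq> 0" "Y * K = - fps_deriv K" "fps_conv_radius K = \<infinity>"
proof -
  show 1: "\<nu> + 1 \<notin> \<int>\<^sub>\<le>\<^sub>0" using \<nu> nonpos_Ints_nonpos by force
  show 0: "K $ 0 = 1" by (simp add: bessel_fps_nth)
  show "K \<noteq> 0" using 0 by auto
  have "inverse K * K = 1" using 0 by (intro inverse_mult_eq_1) auto
  then show "Y * K = - fps_deriv K" by (simp add: Y_def mult.assoc)
  show "fps_conv_radius K = \<infinity>" using 1 by (simp add: fps_conv_radius_bessel_fps)
qed

lemma rayleigh_riccati: "fps_const (\<nu> + 1) * Y + fps_X * fps_deriv Y = 1 + fps_X * (Y * Y)"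
proof -
  have K': "fps_deriv K = - (Y * K)" using K(4) by simp
  have K'': "fps_deriv (fps_deriv K) = - (fps_deriv Y * K) + Y * Y * K"
    unfolding K' fps_deriv_neg fps_deriv_mult by (simp add: K' algebra_simps)
  have "fps_const (-1) * K = - K" by (simp add: fps_eq_iff)
  then have "(fps_const (\<nu> + 1) * Y + fps_X * fps_deriv Y) * K = (1 + fps_X * (Y * Y)) * K"
    using bessel_fps_ode[OF K(1), of "-1"] unfolding K''
    by (simp add: K' algebra_simps)
  then show ?thesis using K(3) by simp
qed

lemma rayleigh_Suc: "(\<nu> + 2 + real n) * Y $ Suc n = (\<Sum>i\<le>n. Y $ i * Y $ (n - i))"
proof -
  have "(fps_const (\<nu> + 1) * Y + fps_X * fps_deriv Y) $ Suc n = (1 + fps_X * (Y * Y)) $ Suc n"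
    by (simp only: rayleigh_riccati)
  then show ?thesis
    by (simp add: fps_mult_nth[of Y Y] atLeast0AtMost algebra_simps)
qed

lemma rayleigh_0: "Y $ 0 = 1 / (\<nu> + 1)"
proof -
  have "(fps_const (\<nu> + 1) * Y + fps_X * fps_deriv Y) $ 0 = (1 + fps_X * (Y * Y)) $ 0"
    by (simp only: rayleigh_riccati)
  then show ?thesis using \<nu> by (simp add: field_simps)
qed

lemma rayleigh_lower_bound: "1 / (\<nu> + 1) * (1 / ((\<nu> + 1) * (\<nu> + 2))) ^ n \<le> Y $ n"
proof (induction n rule: less_induct)
  case (less n)
  define c where "c = 1 / (\<nu> + 1)"
  define q where "q = 1 / ((\<nu> + 1) * (\<nu> + 2))"
  have cq: "0 < c" "0 < q" "c = q * (\<nu> + 2)" using \<nu> by (auto simp: c_def q_def)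
  show ?case
  proof (cases n)
    case 0
    then show ?thesis by (simp add: rayleigh_0)
  next
    case (Suc m)
    have "(\<nu> + 2 + real m) * (c * q ^ Suc m) \<le> real (Suc m) * (\<nu> + 2) * (c * q ^ Suc m)"
    proof (rule mult_right_mono)
      show "\<nu> + 2 + real m \<le> real (Suc m) * (\<nu> + 2)"
        using \<nu> mult_left_mono[of 1 "\<nu> + 2" "real m"] by (simp add: algebra_simps)
      show "0 \<le> c * q ^ Suc m" using cq(1,2) by simp
    qed
    also have "\<dots> = (\<Sum>i\<le>m. c * c * q ^ m)"
      using cq(3) by (simp add: mult_ac)
    also have "\<dots> = (\<Sum>i\<le>m. (c * q ^ i) * (c * q ^ (m - i)))"
    proof (intro sum.cong refl)
      fix i assume "i \<in> {..m}"
      then have "q ^ m = q ^ i * q ^ (m - i)" by (simp flip: power_add)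
      then show "c * c * q ^ m = (c * q ^ i) * (c * q ^ (m - i))" by simp
    qed
    also have "\<dots> \<le> (\<Sum>i\<le>m. Y $ i * Y $ (m - i))"
    proof (intro sum_mono mult_mono)
      fix i assume i: "i \<in> {..m}"
      show "c * q ^ i \<le> Y $ i" "c * q ^ (m - i) \<le> Y $ (m - i)"
        using less.IH[of i] less.IH[of "m - i"] i Suc by (auto simp: c_def q_def)
      then show "0 \<le> Y $ i"
        using cq by (meson less_imp_le mult_nonneg_nonneg order_trans zero_le_power)
    qed (use cq in auto)
    also have "\<dots> = (\<nu> + 2 + real m) * Y $ Suc m" by (simp add: rayleigh_Suc)
    finally have "c * q ^ Suc m \<le> Y $ Suc m"
      by (rule mult_left_le_imp_le) (use \<nu> in simp)
    then show ?thesis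
      by (simp only: Suc c_def q_def)
  qed
qed

lemma rayleigh_nonneg: "0 \<le> Y $ n"
proof -
  have "0 \<le> 1 / (\<nu> + 1) * (1 / ((\<nu> + 1) * (\<nu> + 2))) ^ n"
    using \<nu> by (intro mult_nonneg_nonneg zero_le_power) auto
  then show ?thesis using rayleigh_lower_bound[of n] by linarith
qed

lemma bessel_fps_has_positive_zero: "\<exists>x>0. eval_fps K x = 0"
proof (rule ccontr)
  define r where "r = (\<nu> + 1) * (\<nu> + 2)"
  have r: "0 < r" using \<nu> by (simp add: r_def)
  assume "\<not> ?thesis"
  then have nz: "eval_fps K x \<noteq> 0" if "0 \<le> x" for x
    using that K(2) by (cases "x = 0") (auto simp: eval_fps_at_0)
  have "ereal (2 * r) \<le> fps_conv_radius (inverse K)"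
    using nz K fps_inverse_nonneg_of_logderiv[OF K(2) K(4) rayleigh_nonneg]
    by (intro fps_conv_radius_inverse_nonneg) auto
  also have "\<dots> \<le> fps_conv_radius Y"
    using fps_conv_radius_mult[of "- fps_deriv K" "inverse K"] fps_conv_radius_deriv[of K] K(5)
    by (simp add: Y_def)
  also have "\<dots> \<le> ereal (norm r)"
    unfolding fps_conv_radius_def
  proof (rule conv_radius_leI')
    show "\<not> summable (\<lambda>n. Y $ n * r ^ n)"
    proof
      assume "summable (\<lambda>n. Y $ n * r ^ n)"
      then have "(\<lambda>n. Y $ n * r ^ n) \<longlonglongrightarrow> 0" by (rule summable_LIMSEQ_zero)
      moreover have "1 / (\<nu> + 1) \<le> Y $ n * r ^ n" for n
        using mult_right_mono[OF rayleigh_lower_bound[of n], of "r ^ n"] r \<nu>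
        by (simp add: r_def power_divide)
      ultimately have "1 / (\<nu> + 1) \<le> 0"
        by (intro tendsto_lowerbound[where F = sequentially and f = "\<lambda>n. Y $ n * r ^ n"]) auto
      then show False using \<nu> by simp
    qed
  qed
  finally show False using r by simp
qed

lemma dini_logderiv_nonneg:
  obtains L where "L * dini_fps (-1) \<nu> = - fps_deriv (dini_fps (-1) \<nu>)"
    "\<And>n. 0 \<le> L $ n" "0 < L $ 0"
proof -
  define P where "P = fps_X * (2 * Y)"
  have K': "fps_deriv K = - (Y * K)" using K(4) by simp
  have D: "dini_fps (-1) \<nu> = K * (1 - P)"
    by (simp add: dini_fps_def K' P_def algebra_simps)
  have P0: "P $ 0 = 0" and P: "0 \<le> P $ n" for n
    using rayleigh_nonneg by (auto simp: P_def)
  define Q where "Q = inverse (1 - P)"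
  have inv: "(1 - P) * Q = 1"
    unfolding Q_def using P0 by (intro inverse_mult_eq_1') auto
  define L where "L = Y + fps_deriv P * Q"
  show ?thesis
  proof
    have "L * dini_fps (-1) \<nu> = Y * K * (1 - P) + fps_deriv P * K * ((1 - P) * Q)"
      by (simp add: L_def D algebra_simps)
    also have "\<dots> = Y * K * (1 - P) + fps_deriv P * K" unfolding inv by simp
    also have "\<dots> = - fps_deriv (dini_fps (-1) \<nu>)"
      by (simp add: D K' algebra_simps)
    finally show "L * dini_fps (-1) \<nu> = - fps_deriv (dini_fps (-1) \<nu>)" .
    have "0 \<le> (fps_deriv P * Q) $ n" for n
      unfolding Q_def by (intro fps_mult_nonneg fps_deriv_nonneg P fps_inverse_one_minus_nonneg P0)
    then show "0 \<le> L $ n" for n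
      using rayleigh_nonneg[of n] by (simp add: L_def)
    show "0 < L $ 0"
      using rayleigh_0 \<nu> P0 by (simp add: L_def P_def Q_def)
  qed
qed

end

lemma fps_first_positive_zero:
  fixes f :: "real fps"
  assumes "fps_conv_radius f = \<infinity>" "f $ 0 \<noteq> 0" "0 < x" "eval_fps f x = 0"
  obtains \<rho> where "0 < \<rho>" "\<rho> \<le> x" "eval_fps f \<rho> = 0" "\<And>y. 0 < y \<Longrightarrow> y < \<rho> \<Longrightarrow> eval_fps f y \<noteq> 0"
proof -
  define Z where "Z = {0..x} \<inter> {y. eval_fps f y = 0}"
  have "continuous_on UNIV (eval_fps f)"
    using continuous_on_eval_fps[of f] assms by simp
  then have "closed {y. eval_fps f y = 0}"
    by (intro closed_Collect_eq continuous_on_const)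
  then have "compact Z" unfolding Z_def by (intro compact_Int_closed compact_Icc)
  moreover have "x \<in> Z" using assms by (simp add: Z_def)
  ultimately obtain \<rho> where \<rho>: "\<rho> \<in> Z" "\<And>y. y \<in> Z \<Longrightarrow> \<rho> \<le> y"
    using compact_attains_inf[of Z] by auto
  moreover have "0 \<notin> Z" using assms by (simp add: Z_def eval_fps_at_0)
  ultimately show ?thesis
    using that[of \<rho>] by (force simp: Z_def less_le)
qed

lemma is_first_positive_zeroI:
  assumes "0 < s" "\<And>t. 0 < t \<Longrightarrow> t \<le> s \<Longrightarrow> F (of_real (2 * sqrt t)) = 0 \<longleftrightarrow> t = s"
  shows "is_first_positive_zero F (2 * sqrt s)"
  unfolding is_first_positive_zero_def
proof (intro conjI allI impI)
  fix y assume y: "0 < y \<and> y < 2 * sqrt s"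
  then have "y\<^sup>2 < (2 * sqrt s)\<^sup>2" by (intro power_strict_mono) auto
  then have "y\<^sup>2 / 4 < s" using assms by (simp add: power_mult_distrib)
  then show "F (of_real y) \<noteq> 0"
    using assms(2)[of "y\<^sup>2 / 4"] y by (simp add: real_sqrt_divide)
qed (use assms in auto)

lemma square_sqrt_of_real: "0 \<le> t \<Longrightarrow> (complex_of_real (2 * sqrt t))\<^sup>2 / 4 = of_real t"
  by (simp add: power_mult_distrib flip: of_real_power)

section \<open>The radius of uniform convexity\<close>

lemma uniform_convexity_bessel_g_gt_minus_one:
  assumes \<nu>: "- 1 < \<nu>"
  shows "\<exists>r \<alpha> j. is_first_positive_zero (uc_eq_J \<nu>) r \<and>
        radius_uniform_convexity (bessel_g \<nu>) = ereal r \<and>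
        is_first_positive_zero (dini \<nu>) \<alpha> \<and>
        is_first_positive_zero (bessel_J \<nu>) j \<and>
        r < \<alpha> \<and> \<alpha> < j"
proof -
  let ?K = "bessel_fps (-1) \<nu>" and ?D = "dini_fps (-1) \<nu>"
  have \<nu>1: "\<nu> + 1 \<notin> \<int>\<^sub>\<le>\<^sub>0" using \<nu> nonpos_Ints_nonpos by force
  have rK: "fps_conv_radius ?K = \<infinity>" and rD: "fps_conv_radius ?D = \<infinity>"
    using \<nu>1 by (simp_all add: fps_conv_radius_bessel_fps fps_conv_radius_dini_fps)
  have K0: "?K $ 0 \<noteq> 0" and D0: "?D $ 0 \<noteq> 0" by (auto simp: bessel_fps_nth dini_fps_nth)
  obtain \<kappa> where \<kappa>: "0 < \<kappa>" "eval_fps ?K \<kappa> = 0" "\<And>y. 0 < y \<Longrightarrow> y < \<kappa> \<Longrightarrow> eval_fps ?K y \<noteq> 0"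
    using bessel_fps_has_positive_zero[OF \<nu>] fps_first_positive_zero[OF rK K0] by metis
  \<comment> \<open>Rolle's theorem for \<open>x K(x)\<^sup>2\<close>, whose derivative is \<open>K(x) D(x)\<close>\<close>
  have "\<exists>x>0. x < \<kappa> \<and> eval_fps ?K x * eval_fps ?D x = 0"
  proof -
    have rK': "fps_conv_radius (fps_deriv ?K) = \<infinity>"
      using rK fps_conv_radius_deriv[of ?K] by simp
    have D: "eval_fps ?D x = eval_fps ?K x + 2 * x * eval_fps (fps_deriv ?K) x" for x
      using arg_cong[OF dini_fun_eq[OF \<nu>1, of "-1" "of_real x"], of Re] rK rK' rD
      by (simp add: dini_fun_def bessel_fun_def bessel_fun'_def eval_complex_fps_of_real)
    let ?f = "\<lambda>x. x * (eval_fps ?K x)\<^sup>2" and ?f' = "\<lambda>x. eval_fps ?K x * eval_fps ?D x"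
    have d: "(?f has_real_derivative ?f' x) (at x)" for x
      unfolding D
      by (rule derivative_eq_intros has_real_derivative_eval_fps[OF rK] refl)+
         (simp add: algebra_simps power2_eq_square)
    have "\<exists>z>0. z < \<kappa> \<and> (\<lambda>h. h * ?f' z) = (\<lambda>v. 0)"
    proof (rule Rolle_deriv[of 0 \<kappa> ?f "\<lambda>x h. h * ?f' x"])
      show "(?f has_derivative (\<lambda>h. h * ?f' x)) (at x)" for x
        using d[of x] by (simp add: has_field_derivative_def mult_commute_abs)
      show "continuous_on {0..\<kappa>} ?f"
        using d by (intro continuous_at_imp_continuous_on) (auto intro: DERIV_isCont)
    qed (use \<kappa> in auto)
    then show ?thesis by (metis mult_1)
  qed
  then obtain x where x: "0 < x" "x < \<kappa>" "eval_fps ?D x = 0"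
    using \<kappa>(3) by auto
  obtain \<rho> where \<rho>: "0 < \<rho>" "\<rho> \<le> x" "eval_fps ?D \<rho> = 0" "\<And>y. 0 < y \<Longrightarrow> y < \<rho> \<Longrightarrow> eval_fps ?D y \<noteq> 0"
    using fps_first_positive_zero[OF rD D0 x(1,3)] by metis
  obtain L where L: "L * ?D = - fps_deriv ?D" "\<And>n. 0 \<le> L $ n" "0 < L $ 0"
    using dini_logderiv_nonneg[OF \<nu>] by metis
  obtain s where s: "0 < s" "s < \<rho>" "1 + dini_quot (-1) \<nu> (of_real s) = 0"
    "\<And>t. norm t < s \<Longrightarrow> norm (dini_quot (-1) \<nu> t) < 1"
    "\<And>t. norm t < s \<Longrightarrow> dini_fun (-1) \<nu> t \<noteq> 0"
    "\<And>x. 0 < x \<Longrightarrow> x < \<rho> \<Longrightarrow> 1 + dini_quot (-1) \<nu> (of_real x) = 0 \<longleftrightarrow> x = s"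
    using dini_criterion[OF \<nu>1 _ L \<rho>(1,3,4)] by auto
  show ?thesis
  proof (intro exI conjI)
    show "is_first_positive_zero (uc_eq_J \<nu>) (2 * sqrt s)"
      using s by (intro is_first_positive_zeroI) (auto simp: uc_eq_J_eq[OF \<nu>1] square_sqrt_of_real simp del: of_real_mult)
    show "radius_uniform_convexity (bessel_g \<nu>) = ereal (2 * sqrt s)"
      using s by (intro radius_uniform_convexity_bessel_g[OF \<nu>1, of s "of_real s"]) auto
    show "is_first_positive_zero (dini \<nu>) (2 * sqrt \<rho>)"
    proof (rule is_first_positive_zeroI)
      fix t assume t: "0 < t" "t \<le> \<rho>"
      have "dini \<nu> (of_real (2 * sqrt t)) = 0 \<longleftrightarrow> dini_fun (-1) \<nu> (of_real t) = 0"
        using t rGamma_nonzero[OF \<nu>1]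
        by (subst dini_eq[OF \<nu>1]) (auto simp: square_sqrt_of_real complex_nonpos_Reals_iff simp del: of_real_mult)
      also have "\<dots> \<longleftrightarrow> t = \<rho>"
        using \<rho>(3) \<rho>(4)[of t] t by (cases "t = \<rho>") (auto simp: dini_fun_of_real[OF \<nu>1])
      finally show "dini \<nu> (of_real (2 * sqrt t)) = 0 \<longleftrightarrow> t = \<rho>" .
    qed (rule \<rho>)
    show "is_first_positive_zero (bessel_J \<nu>) (2 * sqrt \<kappa>)"
    proof (rule is_first_positive_zeroI)
      fix t assume t: "0 < t" "t \<le> \<kappa>"
      have "bessel_J \<nu> (of_real (2 * sqrt t)) = 0 \<longleftrightarrow> bessel_fun (-1) \<nu> (of_real t) = 0"
        using t rGamma_nonzero[OF \<nu>1]
        by (subst bessel_J_eq[OF \<nu>1]) (auto simp: square_sqrt_of_real simp del: of_real_mult)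
      also have "\<dots> \<longleftrightarrow> t = \<kappa>"
        using \<kappa>(2) \<kappa>(3)[of t] t rK
        by (cases "t = \<kappa>") (auto simp: bessel_fun_def eval_complex_fps_of_real)
      finally show "bessel_J \<nu> (of_real (2 * sqrt t)) = 0 \<longleftrightarrow> t = \<kappa>" .
    qed (rule \<kappa>)
  qed (use s \<rho> x in auto)
qed

lemma dini_fps_pos_nth:
  assumes "- 2 < \<nu>" "\<nu> < - 1" "0 < n"
  shows "dini_fps 1 \<nu> $ n < 0"
proof -
  obtain m where n: "n = Suc m" using assms by (cases n) auto
  have "0 < pochhammer (\<nu> + 1 + 1) m" using assms by (intro pochhammer_pos) auto
  then have "pochhammer (\<nu> + 1) n < 0"
    using assms by (simp add: n pochhammer_rec mult_neg_pos)
  then show ?thesis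
    unfolding dini_fps_nth bessel_fps_nth
    by (intro mult_pos_neg) (auto intro!: divide_pos_neg mult_pos_neg)
qed

lemma uniform_convexity_bessel_g_lt_minus_one:
  assumes \<nu>: "- 2 < \<nu>" "\<nu> < - 1"
  shows "\<exists>a>0. {z. Re z = 0 \<and> z \<noteq> 0 \<and> dini \<nu> z = 0} = {\<i> * of_real a, - (\<i> * of_real a)} \<and>
        (\<exists>r. {x. 0 < x \<and> x < a \<and> uc_eq_I \<nu> (of_real x) = 0} = {r} \<and>
          radius_uniform_convexity (bessel_g \<nu>) = ereal r)"
proof -
  let ?D = "dini_fps 1 \<nu>"
  have \<nu>1: "\<nu> + 1 \<notin> \<int>\<^sub>\<le>\<^sub>0"
  proof
    assume "\<nu> + 1 \<in> \<int>\<^sub>\<le>\<^sub>0"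
    then obtain k where "\<nu> + 1 = of_int k" "k \<le> 0" by (auto elim: nonpos_Ints_cases)
    then have "real_of_int (- 1) < of_int k" "of_int k < real_of_int 0" using \<nu> by auto
    then show False by (simp only: of_int_less_iff)
  qed
  define P where "P = 1 - ?D"
  have D: "?D = 1 - P" by (simp add: P_def)
  have P0: "P $ 0 = 0" by (simp add: P_def dini_fps_nth bessel_fps_nth)
  have Ppos: "0 < P $ n" if "0 < n" for n
    using dini_fps_pos_nth[OF \<nu> that] that by (simp add: P_def)
  have P: "0 \<le> P $ n" for n
    using P0 Ppos[of n] by (cases n) auto
  define L where "L = fps_deriv P * inverse (1 - P)"
  have "inverse (1 - P) * (1 - P) = 1"
    using P0 by (intro inverse_mult_eq_1) auto
  then have L1: "L * ?D = - fps_deriv ?D"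
    by (simp add: L_def D mult.assoc)
  have L2: "0 \<le> L $ n" for n
    unfolding L_def by (intro fps_mult_nonneg fps_deriv_nonneg P fps_inverse_one_minus_nonneg P0)
  have L3: "0 < L $ 0" using P0 Ppos[of 1] by (simp add: L_def)
  have rD: "fps_conv_radius ?D = \<infinity>" using \<nu>1 by (simp add: fps_conv_radius_dini_fps)
  have "fps_conv_radius P = \<infinity>"
    using fps_conv_radius_diff[of 1 ?D] rD by (simp add: P_def)
  then have rP': "fps_conv_radius (fps_deriv P) = \<infinity>"
    using fps_conv_radius_deriv[of P] by simp
  have d: "(eval_fps ?D has_real_derivative - eval_fps (fps_deriv P) x) (at x)" for x
  proof -
    have "eval_fps (fps_deriv ?D) x = - eval_fps (fps_deriv P) x"
      using rP' by (simp add: D eval_fps_minus)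
    then show ?thesis using has_real_derivative_eval_fps[OF rD, of x] by simp
  qed
  have d': "P $ 1 \<le> eval_fps (fps_deriv P) x" if "0 \<le> x" for x
    using eval_fps_real_mono[of "fps_deriv P" 0 x] that P rP' by (simp add: eval_fps_at_0)
  have decr: "eval_fps ?D y < eval_fps ?D x" if "0 \<le> x" "x < y" for x y
  proof (rule DERIV_neg_imp_decreasing[OF that(2)])
    fix z assume "x \<le> z" "z \<le> y"
    then show "\<exists>w. (eval_fps ?D has_real_derivative w) (at z) \<and> w < 0"
      using d[of z] d'[of z] Ppos[of 1] that by (intro exI[of _ "- eval_fps (fps_deriv P) z"]) auto
  qed
  have D0: "eval_fps ?D 0 = 1" by (simp add: eval_fps_at_0 dini_fps_nth bessel_fps_nth)
  have "\<exists>x\<ge>0. x \<le> 1 / P $ 1 \<and> eval_fps ?D x = 0"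
  proof (rule IVT2)
    obtain z where "0 < z" "eval_fps ?D (1 / P $ 1) - eval_fps ?D 0 = (1 / P $ 1 - 0) * - eval_fps (fps_deriv P) z"
      using MVT2[of 0 "1 / P $ 1" "eval_fps ?D" "\<lambda>x. - eval_fps (fps_deriv P) x"] d Ppos[of 1] by auto
    then have "P $ 1 * eval_fps ?D (1 / P $ 1) \<le> 0"
      using d'[of z] D0 Ppos[of 1] by (simp add: field_simps)
    then show "eval_fps ?D (1 / P $ 1) \<le> 0"
      using Ppos[of 1] by (simp add: mult_le_0_iff)
  qed (use D0 Ppos[of 1] d DERIV_isCont in auto)
  then obtain \<rho> where \<rho>0: "0 \<le> \<rho>" "eval_fps ?D \<rho> = 0" by auto
  then have \<rho>: "0 < \<rho>" using D0 by (cases "\<rho> = 0") auto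
  have zero_iff: "eval_fps ?D x = 0 \<longleftrightarrow> x = \<rho>" if "0 \<le> x" for x
    using decr[of x \<rho>] decr[of \<rho> x] \<rho>0 that by (cases x \<rho> rule: linorder_cases) auto
  obtain s where s: "0 < s" "s < \<rho>" "1 + dini_quot 1 \<nu> (of_real s) = 0"
    "\<And>t. norm t < s \<Longrightarrow> norm (dini_quot 1 \<nu> t) < 1"
    "\<And>t. norm t < s \<Longrightarrow> dini_fun 1 \<nu> t \<noteq> 0"
    "\<And>x. 0 < x \<Longrightarrow> x < \<rho> \<Longrightarrow> 1 + dini_quot 1 \<nu> (of_real x) = 0 \<longleftrightarrow> x = s"
    using dini_criterion[OF \<nu>1 _ L1 L2 L3 \<rho> \<rho>0(2)] zero_iff by auto
  note flip = dini_fun_uminus[OF \<nu>1, of 1, simplified]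
  have sq: "y\<^sup>2 / 4 = t \<longleftrightarrow> y = 2 * sqrt t \<or> y = - (2 * sqrt t)" if "0 < t" for t y :: real
  proof -
    have "y\<^sup>2 / 4 = t \<longleftrightarrow> y\<^sup>2 = (2 * sqrt t)\<^sup>2" using that by (auto simp: power_mult_distrib)
    then show ?thesis by (simp only: power2_eq_iff)
  qed
  have imag: "dini \<nu> z = 0 \<longleftrightarrow> z = \<i> * of_real (2 * sqrt \<rho>) \<or> z = - (\<i> * of_real (2 * sqrt \<rho>))"
    if "Re z = 0" "z \<noteq> 0" for z
  proof -
    have "z \<notin> \<real>\<^sub>\<le>\<^sub>0" using that by (auto simp: complex_nonpos_Reals_iff complex_eq_iff)
    moreover have "z\<^sup>2 / 4 = - of_real ((Im z)\<^sup>2 / 4)"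
      using that by (simp add: complex_eq_iff power2_eq_square)
    ultimately have "dini \<nu> z = 0 \<longleftrightarrow> eval_fps ?D ((Im z)\<^sup>2 / 4) = 0"
      using rGamma_nonzero[OF \<nu>1] that dini_fun_of_real[OF \<nu>1, of 1 "(Im z)\<^sup>2 / 4"]
      by (simp add: dini_eq[OF \<nu>1] flip)
    also have "\<dots> \<longleftrightarrow> (Im z)\<^sup>2 / 4 = \<rho>"
      by (rule zero_iff) simp
    also have "\<dots> \<longleftrightarrow> Im z = 2 * sqrt \<rho> \<or> Im z = - (2 * sqrt \<rho>)"
      by (rule sq[OF \<rho>])
    finally show ?thesis using that by (auto simp: complex_eq_iff)
  qed
  have roots: "uc_eq_I \<nu> (of_real x) = 0 \<longleftrightarrow> x = 2 * sqrt s" if "0 < x" "x < 2 * sqrt \<rho>" for x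
  proof -
    have "x\<^sup>2 < (2 * sqrt \<rho>)\<^sup>2" using that by (intro power_strict_mono) auto
    then have "x\<^sup>2 / 4 < \<rho>" using \<rho> by (simp add: power_mult_distrib)
    then have "uc_eq_I \<nu> (of_real x) = 0 \<longleftrightarrow> x\<^sup>2 / 4 = s"
      using s(6)[of "x\<^sup>2 / 4"] that by (simp add: uc_eq_I_eq[OF \<nu>1])
    then show ?thesis using sq[OF s(1), of x] that s(1) by auto
  qed
  show ?thesis
  proof (intro exI conjI)
    show "0 < 2 * sqrt \<rho>" using \<rho> by simp
    show "{z. Re z = 0 \<and> z \<noteq> 0 \<and> dini \<nu> z = 0}
        = {\<i> * of_real (2 * sqrt \<rho>), - (\<i> * of_real (2 * sqrt \<rho>))}"
      using imag \<rho> by auto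
    show "{x. 0 < x \<and> x < 2 * sqrt \<rho> \<and> uc_eq_I \<nu> (of_real x) = 0} = {2 * sqrt s}"
      using roots s by (auto simp del: of_real_mult)
    show "radius_uniform_convexity (bessel_g \<nu>) = ereal (2 * sqrt s)"
      using s by (intro radius_uniform_convexity_bessel_g[OF \<nu>1, of s "- of_real s"]) (auto simp: flip)
  qed
qed

theorem theorem3p2:
  fixes \<nu> :: real
  shows "(\<nu> > -1 \<longrightarrow>
      (\<exists>r \<alpha> j. is_first_positive_zero (uc_eq_J \<nu>) r \<and>
        radius_uniform_convexity (bessel_g \<nu>) = ereal r \<and>
        is_first_positive_zero (dini \<nu>) \<alpha> \<and>
        is_first_positive_zero (bessel_J \<nu>) j \<and>
        r < \<alpha> \<and> \<alpha> < j)) \<and>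
    (-2 < \<nu> \<and> \<nu> < -1 \<longrightarrow>
      (\<exists>a>0. {z. Re z = 0 \<and> z \<noteq> 0 \<and> dini \<nu> z = 0} = {\<i> * of_real a, - (\<i> * of_real a)} \<and>
        (\<exists>r. {x. 0 < x \<and> x < a \<and> uc_eq_I \<nu> (of_real x) = 0} = {r} \<and>
          radius_uniform_convexity (bessel_g \<nu>) = ereal r)))"
  using uniform_convexity_bessel_g_gt_minus_one[of \<nu>] uniform_convexity_bessel_g_lt_minus_one[of \<nu>]
  by blast

end
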